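(* Let $T>0$ and let $H,L:[0,T]\to\mathbb{C}^{N\times N}$ be continuous Hermitian-matrix-valued functions with $L(t)\succeq 0$ for all $t\in[0,T]$, and set $A(t)=L(t)+\mathrm{i}H(t)$. Let $\alpha_{\max}(t)$ be the largest eigenvalue of $L(t)$ and $\eta_{\max}=\int_0^T\alpha_{\max}(t)\,\mathrm{d}t$. Let $a>0$ be real with $\eta_{\max}\le 2\pi a$, let $m\ge 1$, and let $p_1,\dots,p_m\in\mathbb{C}$ be pairwise distinct complex numbers such that $p_r\neq -\mathrm{i}$ for all $r$ and $p_r\notin\{k/a: k\in\mathbb{Z}\}$ for all $r$. Then \[ \mathcal{T}\mathrm{e}^{-\int_{0}^{T}A(s)\mathrm{d}s} -\frac{1}{a}\sum_{k\in\mathbb{Z}}\frac{(\mathrm{e}^{-2\pi a}-1)\,\mathcal{T}\mathrm{e}^{-\mathrm{i}\int_{0}^{T}(H(s)+\frac{k}{a}L(s))\mathrm{d}s}}{2\pi\mathrm{i}\left(\frac{k}{a}+\mathrm{i}\right)\prod_{r=1}^{m}\frac{k/a-p_{r}}{-\mathrm{i}-p_{r}}} -\sum_{r=1}^{m}\frac{(\mathrm{e}^{-2\pi a}-1)\,\mathcal{T}\mathrm{e}^{-\mathrm{i}\int_{0}^{T}(H(s)+p_{r}L(s))\mathrm{d}s}}{(\mathrm{e}^{-2\pi \mathrm{i} p_{r} a}-1)\prod_{r'\neq r}\frac{p_r-p_{r'}}{-\mathrm{i}-p_{r'}}}=0 . \]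
   Context: For a continuous matrix-valued function $B:[0,T]\to\mathbb{C}^{N\times N}$, the time-ordered exponential $\mathcal{T}\mathrm{e}^{-\int_0^T B(s)\,\mathrm{d}s}$ denotes $V(T)$, where $V$ is the unique solution of $\frac{\mathrm{d}V}{\mathrm{d}t}=-B(t)V(t)$, $V(0)=I$. In the terms above, $B(s)=A(s)$, or $B(s)=\mathrm{i}(H(s)+zL(s))$ with $z=k/a$ or $z=p_r$ (complex in general). $L(t)\succeq 0$ means $L(t)$ is positive semidefinite. *)

theory Defs
  imports "HOL-Analysis.Analysis"
begin

type_synonym 'n cmat = "complex ^ 'n ^ 'n"

definition cmat_scale :: "complex \<Rightarrow> ('n::finite) cmat \<Rightarrow> 'n cmat" where
  "cmat_scale c M = (\<chi> i j. c * M $ i $ j)"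

definition hermitian :: "('n::finite) cmat \<Rightarrow> bool" where
  "hermitian M \<longleftrightarrow> (\<forall>i j. M $ i $ j = cnj (M $ j $ i))"

definition psd :: "('n::finite) cmat \<Rightarrow> bool" where
  "psd M \<longleftrightarrow> (\<forall>x :: complex ^ 'n.
      let q = (\<Sum>i\<in>UNIV. \<Sum>j\<in>UNIV. cnj (x $ i) * M $ i $ j * x $ j) in Im q = 0 \<and> Re q \<ge> 0)"

definition max_eig :: "('n::finite) cmat \<Rightarrow> real" where
  "max_eig M = Max {e::real. \<exists>v :: complex ^ 'n. v \<noteq> 0 \<and> M *v v = complex_of_real e *s v}"

definition texp :: "real \<Rightarrow> (real \<Rightarrow> ('n::finite) cmat) \<Rightarrow> 'n cmat" where
  "texp T B = (THE M. \<exists>V :: real \<Rightarrow> 'n cmat. V 0 = mat 1 \<and>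
      (\<forall>t\<in>{0..T}. (V has_vector_derivative - (B t ** V t)) (at t within {0..T})) \<and> V T = M)"

end

theory Submission
  imports Defs "HOL-Complex_Analysis.Residue_Theorem"
begin

text \<open>
  Let \<open>U z\<close> be the time-ordered exponential generated by \<open>i (H + z L)\<close>, so that the target is
  \<open>U (- i)\<close>. The Dyson series shows that \<open>U\<close> is entire. Differentiating the squared norm of a
  solution, the Hermitian part of the generator contributes \<open>2 Im z\<close> times the quadratic form
  of \<open>L\<close>, hence \<open>U\<close> is bounded in the lower half plane and grows at most like
  \<open>exp (eta_max Im z)\<close> in the upper one. Since \<open>eta_max \<le> 2 pi a\<close>, dividing \<open>U z\<close> by
  \<open>(exp (- 2 pi i a z) - 1) (z + i) \<Prod>r. (z - p r) / (- i - p r)\<close> gives a meromorphic function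
  that is \<open>O(1 / |z| ^ (m + 1))\<close> on squares through the half-integer points \<open>(N + 1/2) / a\<close>.
  With \<open>m \<ge> 1\<close> the contour integrals tend to zero, and the vanishing sum of the residues at
  \<open>k / a\<close>, \<open>- i\<close> and \<open>p r\<close> is the claimed identity.
\<close>

text \<open>The obstacle is growth: a bound through the norm of the generator would be exponential
  in \<open>|z|\<close> in every direction and would also pay for \<open>H\<close>. The one-sided
  energy estimate sees only the Hermitian part and leaves the profile
  \<open>exp (2 pi a max 0 (Im z))\<close>. On the chosen squares the kernel
  \<open>exp (- 2 pi i a z) - 1\<close> is at least half of that same profile, so the quotient of
  \<open>U\<close> by the kernel stays bounded there, even at the borderline type
  \<open>2 pi a\<close>. The factor \<open>1 / (z + i)\<close> alone would only balance the
  perimeter; a node \<open>p r\<close> supplies the missing decay. The same decay makes the series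
  over \<open>k / a\<close> absolutely convergent, so its unconditional sum agrees with the
  symmetric partial sums that the contours produce. The weights are forced: the product over the
  nodes is \<open>1\<close> at \<open>- i\<close>, so multiplying by the kernel value
  \<open>exp (- 2 pi a) - 1\<close> turns the residue at \<open>- i\<close> into the target, and
  this is the common numerator of all other terms. All poles are simple or removable because the
  points \<open>k / a\<close>, \<open>- i\<close> and \<open>p r\<close> are distinct.\<close>

section \<open>Time-ordered exponentials\<close>

text \<open>The \<open>n\<close>-fold iterate is the \<open>n\<close>-th term of the Dyson series, not its partial sum.\<close>

definition dyson :: "(real \<Rightarrow> ('n::finite) cmat) \<Rightarrow> nat \<Rightarrow> real \<Rightarrow> 'n cmat" where
  "dyson B n = ((\<lambda>F t. integral {0..t} (\<lambda>s. - (B s ** F s))) ^^ n) (\<lambda>_. mat 1)"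

lemma dyson_0: "dyson B 0 t = mat 1"
  by (simp add: dyson_def)

lemma dyson_Suc: "dyson B (Suc n) t = integral {0..t} (\<lambda>s. - (B s ** dyson B n s))"
  by (simp add: dyson_def)

lemma bounded_bilinear_matrix_matrix_mult:
  "bounded_bilinear ((**) :: ('n::finite) cmat \<Rightarrow> 'n cmat \<Rightarrow> 'n cmat)"
proof -
  have "bilinear ((**) :: 'n cmat \<Rightarrow> 'n cmat \<Rightarrow> 'n cmat)"
    unfolding bilinear_def
    by (auto intro!: linearI simp: vec_eq_iff matrix_matrix_mult_def sum.distrib algebra_simps scaleR_sum_right)
  then show ?thesis by (simp add: bilinear_conv_bounded_bilinear)
qed

lemma bounded_bilinear_matrix_vector_mult:
  "bounded_bilinear ((*v) :: ('n::finite) cmat \<Rightarrow> complex ^ 'n \<Rightarrow> complex ^ 'n)"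
proof -
  have "bilinear ((*v) :: 'n cmat \<Rightarrow> complex ^ 'n \<Rightarrow> complex ^ 'n)"
    unfolding bilinear_def
    by (auto intro!: linearI simp: vec_eq_iff matrix_vector_mult_def sum.distrib algebra_simps scaleR_sum_right)
  then show ?thesis by (simp add: bilinear_conv_bounded_bilinear)
qed

lemma bounded_bilinear_cmat_scale:
  "bounded_bilinear (cmat_scale :: complex \<Rightarrow> ('n::finite) cmat \<Rightarrow> 'n cmat)"
proof -
  have "bilinear (cmat_scale :: complex \<Rightarrow> 'n cmat \<Rightarrow> 'n cmat)"
    unfolding bilinear_def
    by (auto intro!: linearI simp: vec_eq_iff cmat_scale_def algebra_simps)
  then show ?thesis by (simp add: bilinear_conv_bounded_bilinear)
qed

lemmas continuous_on_matrix_matrix_mult =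
  bounded_bilinear.continuous_on[OF bounded_bilinear_matrix_matrix_mult]
lemmas continuous_on_cmat_scale =
  bounded_bilinear.continuous_on[OF bounded_bilinear_cmat_scale]

text \<open>Any finite constant will do: \<open>K\<close> enters only the majorants of the Dyson
  series and the uniqueness argument, never the sharp growth rate.\<close>

lemma cmat_mult_bound:
  obtains K where "K > 0" "\<And>(A::('n::finite) cmat) (C::'n cmat). norm (A ** C) \<le> K * norm A * norm C"
  using bounded_bilinear.pos_bounded[OF bounded_bilinear_matrix_matrix_mult]
  by (metis mult.commute mult.assoc)

section \<open>Convergence of the Dyson series\<close>

lemma continuous_on_dyson:
  assumes "continuous_on {0..T} B"
  shows "continuous_on {0..T} (dyson B n)"
proof (induction n)
  case 0
  then show ?case by (simp add: dyson_0[abs_def])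
next
  case (Suc n)
  then have "(\<lambda>s. - (B s ** dyson B n s)) integrable_on {0..T}"
    using assms
    by (intro integrable_continuous_real continuous_on_minus continuous_on_matrix_matrix_mult)
  then show ?case
    unfolding dyson_Suc[abs_def] by (rule indefinite_integral_continuous_1)
qed

text \<open>The factor \<open>t ^ n / fact n\<close> is the volume of the simplex of ordered times,
  obtained by integrating the previous bound once more. \<open>M\<close> bounds left multiplication
  by \<open>B s\<close>, which absorbs the constant of the matrix product.\<close>

lemma norm_dyson_le:
  fixes B :: "real \<Rightarrow> ('n::finite) cmat"
  assumes B: "continuous_on {0..T} B"
    and M: "M \<ge> 0" "\<And>s (X::'n cmat). s \<in> {0..T} \<Longrightarrow> norm (B s ** X) \<le> M * norm X"
    and t: "t \<in> {0..T}"
  shows "norm (dyson B n t) \<le> norm (mat 1 :: 'n cmat) * ((M * t) ^ n / fact n)"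
  using t
proof (induction n arbitrary: t)
  case 0
  then show ?case by (simp add: dyson_0)
next
  case (Suc n)
  define c where "c = norm (mat 1 :: 'n cmat)"
  have "((\<lambda>s. M * (c * ((M * s) ^ n / fact n))) has_integral
      c * ((M * t) ^ Suc n / fact (Suc n)) - c * ((M * 0) ^ Suc n / fact (Suc n))) {0..t}"
  proof (rule fundamental_theorem_of_calculus)
    fix s
    have "((\<lambda>s. (M * s) ^ Suc n) has_field_derivative of_nat (Suc n) * (M * s) ^ n * M) (at s within {0..t})"
      using DERIV_power[OF DERIV_cmult_Id[of M s "{0..t}"], of "Suc n"]
      by (simp add: mult_ac del: power_Suc of_nat_Suc)
    then have "((\<lambda>s. c / fact (Suc n) * (M * s) ^ Suc n) has_field_derivative
        c / fact (Suc n) * (of_nat (Suc n) * (M * s) ^ n * M)) (at s within {0..t})"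
      by (rule DERIV_cmult)
    moreover have "c / fact (Suc n) * (of_nat (Suc n) * (M * s) ^ n * M) = M * (c * ((M * s) ^ n / fact n))"
      by (simp add: field_simps del: of_nat_Suc)
    ultimately show "((\<lambda>s. c * ((M * s) ^ Suc n / fact (Suc n))) has_vector_derivative
        M * (c * ((M * s) ^ n / fact n))) (at s within {0..t})"
      unfolding has_real_derivative_iff_has_vector_derivative[symmetric]
      by (simp only: times_divide_eq_right times_divide_eq_left)
  qed (use Suc in auto)
  then have int: "((\<lambda>s. M * (c * ((M * s) ^ n / fact n))) has_integral c * ((M * t) ^ Suc n / fact (Suc n))) {0..t}"
    by simp
  have sub: "{0..t} \<subseteq> {0..T}" using Suc.prems by auto
  have "norm (integral {0..t} (\<lambda>s. - (B s ** dyson B n s))) \<le> integral {0..t} (\<lambda>s. M * (c * ((M * s) ^ n / fact n)))"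
  proof (rule integral_norm_bound_integral)
    show "(\<lambda>s. - (B s ** dyson B n s)) integrable_on {0..t}"
      using continuous_on_subset[OF B sub] continuous_on_subset[OF continuous_on_dyson[OF B] sub]
      by (intro integrable_continuous_real continuous_on_minus continuous_on_matrix_matrix_mult)
    show "(\<lambda>s. M * (c * ((M * s) ^ n / fact n))) integrable_on {0..t}"
      using int by blast
    show "norm (- (B s ** dyson B n s)) \<le> M * (c * ((M * s) ^ n / fact n))" if "s \<in> {0..t}" for s
    proof -
      have s: "s \<in> {0..T}" using that sub by auto
      have "norm (- (B s ** dyson B n s)) \<le> M * norm (dyson B n s)" using M(2)[OF s] by simp
      also have "\<dots> \<le> M * (c * ((M * s) ^ n / fact n))"
        unfolding c_def by (intro mult_left_mono Suc.IH s M(1))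
      finally show ?thesis .
    qed
  qed
  then show ?case using integral_unique[OF int] by (simp only: dyson_Suc c_def)
qed

text \<open>The index set is arbitrary so that it can be the time interval and also a compact set of
  pairs of parameter and time.\<close>

lemma uniform_bound_cmat_mult:
  fixes B :: "'a \<Rightarrow> ('n::finite) cmat"
  assumes "bounded (B ` X)"
  obtains M where "M \<ge> 0" "\<And>s (Y::'n cmat). s \<in> X \<Longrightarrow> norm (B s ** Y) \<le> M * norm Y"
proof -
  obtain K where K: "K > 0" "\<And>(A::'n cmat) (C::'n cmat). norm (A ** C) \<le> K * norm A * norm C"
    using cmat_mult_bound by blast
  obtain b where b: "b > 0" "\<And>s. s \<in> X \<Longrightarrow> norm (B s) \<le> b"
    using assms unfolding bounded_pos by auto
  show thesis
  proof
    show "K * b \<ge> 0" using K b by simp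
    fix s and Y :: "'n cmat" assume "s \<in> X"
    then have "K * norm (B s) * norm Y \<le> K * b * norm Y"
      using K b by (intro mult_mono) auto
    then show "norm (B s ** Y) \<le> K * b * norm Y" using K(2)[of "B s" Y] by linarith
  qed
qed

lemma summable_dyson_majorant: "summable (\<lambda>n. c * ((x::real) ^ n / fact n))"
  using summable_exp[of x] by (intro summable_mult) (simp add: field_simps)

text \<open>Summation is exchanged with integration, not with differentiation: uniform convergence
  gives the Picard integral equation, and continuity of the sum turns that into the differential
  equation.\<close>

lemma dyson_series_solves:
  fixes B :: "real \<Rightarrow> ('n::finite) cmat"
  assumes B: "continuous_on {0..T} B" and "t \<in> {0..T}"
  shows "((\<lambda>t. \<Sum>n. dyson B n t) has_vector_derivative - (B t ** (\<Sum>n. dyson B n t))) (at t within {0..T})"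
proof -
  define V where "V t = (\<Sum>n. dyson B n t)" for t
  define c where "c = norm (mat 1 :: 'n cmat)"
  obtain M where M: "M \<ge> 0" "\<And>s (Y::'n cmat). s \<in> {0..T} \<Longrightarrow> norm (B s ** Y) \<le> M * norm Y"
    using uniform_bound_cmat_mult[OF compact_imp_bounded[OF compact_continuous_image[OF B compact_Icc]]]
    by blast
  have maj: "norm (dyson B n s) \<le> c * ((M * T) ^ n / fact n)" if s: "s \<in> {0..T}" for n s
  proof -
    have "norm (dyson B n s) \<le> c * ((M * s) ^ n / fact n)"
      unfolding c_def using norm_dyson_le[OF B M(1) _ s] M(2) by blast
    also have "\<dots> \<le> c * ((M * T) ^ n / fact n)"
      using M(1) s by (intro mult_left_mono divide_right_mono power_mono) (auto simp: c_def)
    finally show ?thesis .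
  qed
  have ul: "uniform_limit {0..T} (\<lambda>N s. \<Sum>n<N. dyson B n s) V sequentially"
    unfolding V_def by (rule Weierstrass_m_test[OF maj summable_dyson_majorant])
  have contV: "continuous_on {0..T} V"
    by (rule uniform_limit_theorem[OF _ ul])
      (auto intro!: always_eventually continuous_on_sum continuous_on_dyson[OF B])
  have sums: "(\<lambda>n. dyson B n s) sums V s" if s: "s \<in> {0..T}" for s
  proof -
    have "summable (\<lambda>n. norm (dyson B n s))"
      by (rule summable_comparison_test'[OF summable_dyson_majorant[of c "M * T"], of 0])
        (use maj[OF s] in simp)
    then show ?thesis unfolding V_def by (rule summable_sums[OF summable_norm_cancel])
  qed
  have sums': "(\<lambda>n. - (B s ** dyson B n s)) sums - (B s ** V s)" if s: "s \<in> {0..T}" for s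
    by (intro sums_minus bounded_linear.sums[OF bounded_bilinear.bounded_linear_right[OF
          bounded_bilinear_matrix_matrix_mult]] sums s)
  have eq: "V s = mat 1 + integral {0..s} (\<lambda>r. - (B r ** V r))" if s: "s \<in> {0..T}" for s
  proof -
    have sub: "{0..s} \<subseteq> {0..T}" using s by auto
    define g where "g = (\<lambda>N r. \<Sum>n<N. - (B r ** dyson B n r))"
    have contg: "continuous_on {0..s} (\<lambda>r. - (B r ** dyson B n r))" for n
      using continuous_on_subset[OF B sub] continuous_on_subset[OF continuous_on_dyson[OF B] sub]
      by (intro continuous_on_minus continuous_on_matrix_matrix_mult)
    have ulg: "uniform_limit {0..s} g (\<lambda>r. \<Sum>n. - (B r ** dyson B n r)) sequentially"
      unfolding g_def
    proof (rule Weierstrass_m_test[OF _ summable_dyson_majorant])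
      fix n r assume r: "r \<in> {0..s}"
      have "norm (- (B r ** dyson B n r)) \<le> M * norm (dyson B n r)"
        using M(2)[of r] r sub by auto
      also have "\<dots> \<le> M * (c * ((M * T) ^ n / fact n))"
        using maj[of r] r sub M(1) by (intro mult_left_mono) auto
      finally show "norm (- (B r ** dyson B n r)) \<le> M * c * ((M * T) ^ n / fact n)" by simp
    qed
    have contG: "continuous_on {0..s} (g N)" for N
      unfolding g_def by (intro continuous_on_sum contg)
    obtain I J where I: "\<And>N. (g N has_integral I N) {0..s}"
      and J: "((\<lambda>r. \<Sum>n. - (B r ** dyson B n r)) has_integral J) {0..s}" and lim: "I \<longlonglongrightarrow> J"
      using uniform_limit_integral[OF ulg contG sequentially_bot] by blast
    have "integral {0..s} (\<lambda>r. - (B r ** V r)) = J"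
      using J sums_unique[OF sums'] sub
      by (intro integral_unique has_integral_eq[OF _ J]) auto
    moreover have "I N = (\<Sum>n<N. dyson B (Suc n) s)" for N
      using integral_unique[OF I[of N]] unfolding g_def dyson_Suc
      by (subst (asm) integral_sum) (auto intro: integrable_continuous_real contg)
    then have "I = (\<lambda>N. \<Sum>n<N. dyson B (Suc n) s)" by (rule ext)
    then have "(\<lambda>n. dyson B (Suc n) s) sums J"
      using lim by (simp only: sums_def)
    \<comment> \<open>Integration raises the index by one, so the integrated series misses only the
      term of index \<open>0\<close>, the identity matrix.\<close>
    then have "(\<lambda>n. dyson B n s) sums (J + dyson B 0 s)"
      by (rule sums_Suc)
    then have "V s = J + mat 1"
      using sums_unique2[OF sums[OF s]] by (simp only: dyson_0)
    ultimately show ?thesis by simp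
  qed
  have "((\<lambda>s. mat 1 + integral {0..s} (\<lambda>r. - (B r ** V r))) has_vector_derivative 0 + - (B t ** V t)) (at t within {0..T})"
    using assms contV
    by (intro has_vector_derivative_add has_vector_derivative_const integral_has_vector_derivative
        continuous_on_minus continuous_on_matrix_matrix_mult)
  from has_vector_derivative_transform[OF assms(2) eq this]
  have "(V has_vector_derivative - (B t ** V t)) (at t within {0..T})"
    by simp
  then show ?thesis by (simp add: V_def[abs_def])
qed

lemma dyson_at_0: "(\<Sum>n. dyson B n 0) = mat 1"
proof -
  have "dyson B n 0 = (if n = 0 then mat 1 else 0)" for n
    by (cases n) (auto simp: dyson_0 dyson_Suc)
  then show ?thesis using suminf_finite[of "{0}" "\<lambda>n. dyson B n 0"] by simp
qed

section \<open>Energy estimate, uniqueness and growth\<close>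

text \<open>The integrating factor \<open>exp (- 2 * b t)\<close> makes the weighted squared norm
  nonincreasing. Only the one-sided quantity \<open>V' t \<bullet> V t\<close> is controlled, so
  \<open>\<beta>\<close> may have either sign and a skew-Hermitian part of a generator costs
  nothing. It serves both for the difference of two solutions and for the growth bound.\<close>

lemma gronwall_norm:
  fixes V V' :: "real \<Rightarrow> 'a::euclidean_space"
  assumes "0 \<le> T"
    and V: "\<And>t. t \<in> {0..T} \<Longrightarrow> (V has_vector_derivative V' t) (at t within {0..T})"
    and diss: "\<And>t. t \<in> {0..T} \<Longrightarrow> V' t \<bullet> V t \<le> \<beta> t * (V t \<bullet> V t)"
    and \<beta>: "continuous_on {0..T} \<beta>"
  shows "norm (V T) \<le> exp (integral {0..T} \<beta>) * norm (V 0)"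
proof -
  define b where "b t = integral {0..t} \<beta>" for t
  define g where "g t = exp (- 2 * b t) * (V t \<bullet> V t)" for t
  have b: "(b has_vector_derivative \<beta> t) (at t within {0..T})" if "t \<in> {0..T}" for t
    unfolding b_def by (rule integral_has_vector_derivative[OF \<beta> that])
  have g: "(g has_real_derivative 2 * exp (- 2 * b t) * (V' t \<bullet> V t - \<beta> t * (V t \<bullet> V t))) (at t within {0..T})"
    if "t \<in> {0..T}" for t
  proof -
    have "((\<lambda>t. V t \<bullet> V t) has_real_derivative V t \<bullet> V' t + V' t \<bullet> V t) (at t within {0..T})"
      unfolding has_real_derivative_iff_has_vector_derivative
      by (rule bounded_bilinear.has_vector_derivative[OF bounded_bilinear_inner V[OF that] V[OF that]])
    moreover have "(b has_real_derivative \<beta> t) (at t within {0..T})"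
      using b[OF that] by (simp add: has_real_derivative_iff_has_vector_derivative)
    ultimately show ?thesis
      unfolding g_def by (auto intro!: derivative_eq_intros simp: inner_commute algebra_simps)
  qed
  have "g 0 \<ge> g T"
  proof (rule DERIV_nonpos_imp_decreasing_open[OF \<open>0 \<le> T\<close>])
    show "continuous_on {0..T} g"
      using g by (intro DERIV_continuous_on)
    fix t assume t: "0 < t" "t < T"
    then have "at t within {0..T} = at t" by (intro at_within_interior) auto
    moreover have "2 * exp (- 2 * b t) * (V' t \<bullet> V t - \<beta> t * (V t \<bullet> V t)) \<le> 0"
      using diss[of t] t by (intro mult_nonneg_nonpos) auto
    ultimately show "\<exists>y. DERIV g t :> y \<and> y \<le> 0"
      using g[of t] t by auto
  qed
  then have "exp (- 2 * b T) * (norm (V T))\<^sup>2 \<le> (norm (V 0))\<^sup>2"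
    by (simp add: g_def b_def power2_norm_eq_inner)
  then have "exp (2 * b T) * (exp (- 2 * b T) * (norm (V T))\<^sup>2) \<le> exp (2 * b T) * (norm (V 0))\<^sup>2"
    by (intro mult_left_mono) auto
  then have "(norm (V T))\<^sup>2 \<le> (exp (b T) * norm (V 0))\<^sup>2"
    by (simp add: power_mult_distrib mult_exp_exp flip: mult.assoc exp_double)
  then show ?thesis
    unfolding b_def by (rule power2_le_imp_le) simp
qed

text \<open>\<open>texp\<close> is a definite description, so it can be evaluated only once
  uniqueness is known. The difference of two solutions solves the same linear equation from the
  initial value zero, and the energy estimate with the constant rate \<open>M\<close> makes it
  vanish.\<close>

lemma texp_eq:
  fixes B :: "real \<Rightarrow> ('n::finite) cmat"
  assumes "0 \<le> T" and B: "continuous_on {0..T} B"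
    and V: "V 0 = mat 1" "\<And>t. t \<in> {0..T} \<Longrightarrow> (V has_vector_derivative - (B t ** V t)) (at t within {0..T})"
  shows "texp T B = V T"
  unfolding texp_def
proof (rule the_equality)
  show "\<exists>W. W 0 = mat 1 \<and> (\<forall>t\<in>{0..T}. (W has_vector_derivative - (B t ** W t)) (at t within {0..T})) \<and> W T = V T"
    using V by blast
next
  fix X assume "\<exists>W. W 0 = mat 1 \<and> (\<forall>t\<in>{0..T}. (W has_vector_derivative - (B t ** W t)) (at t within {0..T})) \<and> W T = X"
  then obtain W where W: "W 0 = mat 1" "W T = X"
    "\<And>t. t \<in> {0..T} \<Longrightarrow> (W has_vector_derivative - (B t ** W t)) (at t within {0..T})"
    by blast
  obtain M where M: "M \<ge> 0" "\<And>s (Y::'n cmat). s \<in> {0..T} \<Longrightarrow> norm (B s ** Y) \<le> M * norm Y"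
    using uniform_bound_cmat_mult[OF compact_imp_bounded[OF compact_continuous_image[OF B compact_Icc]]]
    by blast
  have "norm (W T - V T) \<le> exp (integral {0..T} (\<lambda>_. M)) * norm (W 0 - V 0)"
  proof (rule gronwall_norm[OF \<open>0 \<le> T\<close>])
    fix t assume t: "t \<in> {0..T}"
    have "((\<lambda>t. W t - V t) has_vector_derivative - (B t ** W t) - - (B t ** V t)) (at t within {0..T})"
      by (intro has_vector_derivative_diff W(3) V(2) t)
    then show "((\<lambda>t. W t - V t) has_vector_derivative - (B t ** (W t - V t))) (at t within {0..T})"
      by (simp add: bounded_bilinear.diff_right[OF bounded_bilinear_matrix_matrix_mult])
    have "- (B t ** (W t - V t)) \<bullet> (W t - V t) \<le> norm (B t ** (W t - V t)) * norm (W t - V t)"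
      using norm_cauchy_schwarz[of "- (B t ** (W t - V t))"] by simp
    also have "\<dots> \<le> M * norm (W t - V t) * norm (W t - V t)"
      by (intro mult_right_mono M t) auto
    finally show "- (B t ** (W t - V t)) \<bullet> (W t - V t) \<le> M * ((W t - V t) \<bullet> (W t - V t))"
      by (simp add: power2_norm_eq_inner[symmetric] power2_eq_square mult.assoc)
  qed auto
  then show "X = V T" using W V by simp
qed

lemma texp_eq_dyson:
  assumes "0 \<le> T" "continuous_on {0..T} B"
  shows "texp T B = (\<Sum>n. dyson B n T)"
  using assms by (intro texp_eq[where V="\<lambda>t. \<Sum>n. dyson B n t"] dyson_at_0 dyson_series_solves)

text \<open>The factor \<open>norm (mat 1)\<close> is the size of the initial value; in the
  Frobenius norm it exceeds 1 as soon as the dimension does.\<close>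

lemma norm_texp_le:
  fixes B :: "real \<Rightarrow> ('n::finite) cmat"
  assumes "0 \<le> T" "continuous_on {0..T} B" "continuous_on {0..T} \<beta>"
    and diss: "\<And>t (X::'n cmat). t \<in> {0..T} \<Longrightarrow> - (B t ** X) \<bullet> X \<le> \<beta> t * (X \<bullet> X)"
  shows "norm (texp T B) \<le> exp (integral {0..T} \<beta>) * norm (mat 1 :: 'n cmat)"
proof -
  have "norm (\<Sum>n. dyson B n T) \<le> exp (integral {0..T} \<beta>) * norm (\<Sum>n. dyson B n 0)"
    using assms
    by (intro gronwall_norm[where V'="\<lambda>t. - (B t ** (\<Sum>n. dyson B n t))"] dyson_series_solves) auto
  then show ?thesis using assms by (simp add: texp_eq_dyson dyson_at_0)
qed

section \<open>Holomorphic dependence on the parameter\<close>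

text \<open>
  Polynomials in \<open>z\<close> with coefficients continuous in \<open>t\<close>. The class is closed under the Picard
  step, so each Dyson term is visibly entire in \<open>z\<close> and no differentiation under the
  integral sign is needed.
\<close>

inductive poly_family :: "real \<Rightarrow> (complex \<Rightarrow> real \<Rightarrow> ('n::finite) cmat) \<Rightarrow> bool" for T where
  const: "continuous_on {0..T} C \<Longrightarrow> poly_family T (\<lambda>z. C)"
| add: "poly_family T f \<Longrightarrow> poly_family T g \<Longrightarrow> poly_family T (\<lambda>z t. f z t + g z t)"
| scale: "poly_family T f \<Longrightarrow> poly_family T (\<lambda>z t. cmat_scale z (f z t))"
| cong: "poly_family T f \<Longrightarrow> (\<And>z t. t \<in> {0..T} \<Longrightarrow> g z t = f z t) \<Longrightarrow> poly_family T g"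

lemma poly_family_continuous: "poly_family T f \<Longrightarrow> continuous_on {0..T} (f z)"
proof (induction rule: poly_family.induct)
  case (cong f g)
  then show ?case by (metis continuous_on_cong)
qed (auto intro!: continuous_on_add continuous_on_cmat_scale)

lemma poly_family_holomorphic:
  assumes "poly_family T f" "t \<in> {0..T}"
  shows "(\<lambda>z. f z t $ i $ j) holomorphic_on UNIV"
  using assms
proof (induction rule: poly_family.induct)
  case (cong f g)
  then show ?case by simp
qed (auto intro!: holomorphic_intros simp: cmat_scale_def)

lemma poly_family_mult:
  assumes "poly_family T f" "continuous_on {0..T} A"
  shows "poly_family T (\<lambda>z t. A t ** f z t)"
  using assms
proof (induction rule: poly_family.induct)
  case (const C)
  then show ?case by (intro poly_family.const continuous_on_matrix_matrix_mult)
next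
  case (add f g)
  then show ?case by (simp add: matrix_add_ldistrib poly_family.add)
next
  case (scale f)
  have "A t ** cmat_scale z (f z t) = cmat_scale z (A t ** f z t)" for z t
    by (simp add: vec_eq_iff matrix_matrix_mult_def cmat_scale_def sum_distrib_left mult.left_commute)
  then show ?case using scale by (simp add: poly_family.scale)
next
  case (cong f g)
  show ?case by (rule poly_family.cong[OF cong.IH]) (use cong in auto)
qed

text \<open>Rule \<open>cong\<close> earns its place here: the integral is moved through sums and
  scalings only where integrability is known, that is for \<open>t \<in> {0..T}\<close>.\<close>

lemma poly_family_integral:
  assumes "poly_family T f"
  shows "poly_family T (\<lambda>z t. integral {0..t} (f z))"
  using assms
proof (induction rule: poly_family.induct)
  case (const C)
  then show ?case
    by (intro poly_family.const indefinite_integral_continuous_1 integrable_continuous_real)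
next
  case (add f g)
  have int: "h z integrable_on {0..t}" if "poly_family T h" "t \<in> {0..T}" for h z and t :: real
    using that by (intro integrable_continuous_real continuous_on_subset[OF poly_family_continuous]) auto
  show ?case
    by (rule poly_family.cong[OF poly_family.add[OF add.IH]]) (use add int in \<open>intro Henstock_Kurzweil_Integration.integral_add\<close>)
next
  case (scale f)
  have "integral {0..t} (\<lambda>s. cmat_scale z (f z s)) = cmat_scale z (integral {0..t} (f z))"
    if "t \<in> {0..T}" for z t
  proof -
    have "f z integrable_on {0..t}"
      using that scale by (intro integrable_continuous_real continuous_on_subset[OF poly_family_continuous]) auto
    then show ?thesis
      using integral_linear[OF _ bounded_bilinear.bounded_linear_right[OF bounded_bilinear_cmat_scale]]
      by (simp add: o_def)
  qed
  then show ?case by (intro poly_family.cong[OF poly_family.scale[OF scale.IH]])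
next
  case (cong f g)
  show ?case
    by (rule poly_family.cong[OF cong.IH]) (use cong in \<open>auto intro!: Henstock_Kurzweil_Integration.integral_cong\<close>)
qed

text \<open>The entire partial sums converge uniformly on every closed unit disc, because joint
  continuity of the generator in parameter and time gives one majorant for the whole compact
  set.\<close>

lemma holomorphic_texp:
  fixes H L :: "real \<Rightarrow> ('n::finite) cmat"
  assumes "0 \<le> T" and H: "continuous_on {0..T} H" and L: "continuous_on {0..T} L"
  shows "(\<lambda>z. texp T (\<lambda>s. cmat_scale \<i> (H s + cmat_scale z (L s))) $ i $ j) holomorphic_on UNIV"
proof -
  define B where "B z s = cmat_scale \<i> (H s + cmat_scale z (L s))" for z s
  have B: "continuous_on {0..T} (B z)" for z
    unfolding B_def by (intro continuous_on_add continuous_on_cmat_scale continuous_on_const H L)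
  have "poly_family T (\<lambda>z. dyson (B z) n)" for n
  proof (induction n)
    case 0
    then show ?case by (simp add: dyson_0[abs_def] poly_family.const)
  next
    case (Suc n)
    \<comment> \<open>The generator is affine in \<open>z\<close>; this splitting puts the Picard
      integrand into the shape of the rules \<open>add\<close> and \<open>scale\<close>.\<close>
    have "- (B z s ** X) = cmat_scale (- \<i>) (H s) ** X + cmat_scale z (cmat_scale (- \<i>) (L s) ** X)" for z s X
      by (simp add: vec_eq_iff B_def matrix_matrix_mult_def cmat_scale_def sum_distrib_left sum.distrib
          sum_negf algebra_simps)
    moreover have "poly_family T (\<lambda>z s. cmat_scale (- \<i>) (H s) ** dyson (B z) n s +
        cmat_scale z (cmat_scale (- \<i>) (L s) ** dyson (B z) n s))"
      using Suc H L
      by (intro poly_family.add poly_family.scale poly_family_mult continuous_on_cmat_scale continuous_on_const)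
    ultimately show ?case
      unfolding dyson_Suc[abs_def] by (intro poly_family_integral) simp
  qed
  then have hol: "(\<lambda>z. dyson (B z) n T $ i $ j) holomorphic_on UNIV" for n
    using \<open>0 \<le> T\<close> by (intro poly_family_holomorphic) auto
  have "(\<lambda>z. \<Sum>n. dyson (B z) n T $ i $ j) holomorphic_on UNIV"
  proof (rule holomorphic_uniform_sequence[OF open_UNIV])
    show "(\<lambda>z. \<Sum>n<N. dyson (B z) n T $ i $ j) holomorphic_on UNIV" for N
      by (intro holomorphic_on_sum hol)
    fix x :: complex
    have "continuous_on (cball x 1 \<times> {0..T}) (\<lambda>zs. B (fst zs) (snd zs))"
      unfolding B_def
      by (intro continuous_on_add continuous_on_cmat_scale continuous_on_const continuous_on_fst
          continuous_on_id continuous_on_compose2[OF H] continuous_on_compose2[OF L] continuous_on_snd) auto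
    then have "bounded ((\<lambda>zs. B (fst zs) (snd zs)) ` (cball x 1 \<times> {0..T}))"
      by (intro compact_imp_bounded compact_continuous_image compact_Times) auto
    then obtain M where M: "M \<ge> 0"
      "\<And>zs (Y::'n cmat). zs \<in> cball x 1 \<times> {0..T} \<Longrightarrow> norm (B (fst zs) (snd zs) ** Y) \<le> M * norm Y"
      using uniform_bound_cmat_mult by blast
    have "norm (dyson (B z) n T $ i $ j) \<le> norm (mat 1 :: 'n cmat) * ((M * T) ^ n / fact n)"
      if "z \<in> cball x 1" for n z
    proof -
      have "norm (dyson (B z) n T $ i $ j) \<le> norm (dyson (B z) n T)"
        by (meson Finite_Cartesian_Product.norm_nth_le order_trans)
      also have "\<dots> \<le> norm (mat 1 :: 'n cmat) * ((M * T) ^ n / fact n)"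
        using that M(2)[of "(z, _)"] \<open>0 \<le> T\<close> by (intro norm_dyson_le M(1)) (use B in auto)
      finally show ?thesis .
    qed
    then have "uniform_limit (cball x 1) (\<lambda>N z. \<Sum>n<N. dyson (B z) n T $ i $ j)
        (\<lambda>z. \<Sum>n. dyson (B z) n T $ i $ j) sequentially"
      by (intro Weierstrass_m_test[OF _ summable_dyson_majorant])
    then show "\<exists>d>0. cball x d \<subseteq> UNIV \<and> uniform_limit (cball x d) (\<lambda>N z. \<Sum>n<N. dyson (B z) n T $ i $ j)
        (\<lambda>z. \<Sum>n. dyson (B z) n T $ i $ j) sequentially"
      by (intro exI[of _ 1]) auto
  qed
  \<comment> \<open>Taking an entry commutes with the infinite sum only after the matrix series is
    known to converge.\<close>
  moreover have "(\<Sum>n. dyson (B z) n T $ i $ j) = texp T (B z) $ i $ j" for z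
  proof -
    obtain M where M: "M \<ge> 0" "\<And>s (Y::'n cmat). s \<in> {0..T} \<Longrightarrow> norm (B z s ** Y) \<le> M * norm Y"
      using uniform_bound_cmat_mult[OF compact_imp_bounded[OF compact_continuous_image[OF B compact_Icc]]]
      by blast
    have "norm (dyson (B z) n T) \<le> norm (mat 1 :: 'n cmat) * ((M * T) ^ n / fact n)" for n
      using \<open>0 \<le> T\<close> M(2) by (intro norm_dyson_le M(1)) (use B in auto)
    then have "summable (\<lambda>n. norm (dyson (B z) n T))"
      by (intro summable_comparison_test'[OF summable_dyson_majorant[of "norm (mat 1 :: 'n cmat)" "M * T"], of 0])
        simp
    then have "summable (\<lambda>n. dyson (B z) n T)" by (rule summable_norm_cancel)
    then have "(\<lambda>n. dyson (B z) n T) sums texp T (B z)"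
      using texp_eq_dyson[OF \<open>0 \<le> T\<close> B] by (simp add: summable_sums)
    then have "(\<lambda>n. dyson (B z) n T $ i $ j) sums (texp T (B z) $ i $ j)"
      by (intro bounded_linear.sums[OF bounded_linear_vec_nth])
    then show ?thesis by (simp add: sums_iff)
  qed
  ultimately show ?thesis unfolding B_def by simp
qed

section \<open>The largest eigenvalue of a Hermitian matrix\<close>

text \<open>Working over a real inner product space keeps \<open>e\<close> real from the start; a
  complex matrix is used through its real-linear action. A maximizer of the quadratic form on the
  compact unit sphere supplies both the eigenvector and the sharp bound.\<close>

lemma self_adjoint_max_eigenvector:
  fixes f :: "'a::euclidean_space \<Rightarrow> 'a"
  assumes lin: "linear f" and adj: "\<And>x y. f x \<bullet> y = x \<bullet> f y"
  obtains e v where "v \<noteq> 0" "f v = e *\<^sub>R v" "\<And>x. f x \<bullet> x \<le> e * (x \<bullet> x)"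
proof -
  have cont: "continuous_on (sphere 0 1) (\<lambda>x. f x \<bullet> x)"
    using lin by (intro continuous_on_inner linear_continuous_on linear_conv_bounded_linear[THEN iffD1] continuous_on_id)
  have "sphere (0::'a) 1 \<noteq> {}" by simp
  then obtain v where v: "v \<in> sphere 0 1" "\<And>x. x \<in> sphere 0 1 \<Longrightarrow> f x \<bullet> x \<le> f v \<bullet> v"
    using continuous_attains_sup[OF compact_sphere _ cont] by blast
  define e where "e = f v \<bullet> v"
  have v1: "v \<bullet> v = 1" using v(1) by (simp add: norm_eq_1)
  have le: "f x \<bullet> x \<le> e * (x \<bullet> x)" for x
  proof (cases "x = 0")
    case True
    then show ?thesis using lin by (simp add: linear_0)
  next
    case False
    define y where "y = x /\<^sub>R norm x"
    have "f y \<bullet> y \<le> e" unfolding e_def using False by (intro v(2)) (simp add: y_def)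
    moreover have "f y \<bullet> y = (f x \<bullet> x) / (norm x)\<^sup>2"
      using lin by (simp add: y_def linear_scale power2_eq_square field_simps)
    ultimately show ?thesis using False
      by (simp add: field_simps power2_norm_eq_inner)
  qed
  text \<open>
    The quadratic form \<open>e * (x \<bullet> x) - f x \<bullet> x\<close> is nonnegative and vanishes at \<open>v\<close>; its first
    variation in the direction of the residual \<open>w\<close> is \<open>2 * (w \<bullet> w)\<close>, so \<open>w = 0\<close>.
  \<close>
  define w where "w = e *\<^sub>R v - f v"
  define c where "c = e * (w \<bullet> w) - f w \<bullet> w"
  have "0 \<le> 2 * t * (w \<bullet> w) + t\<^sup>2 * c" for t
  proof -
    have "f (v + t *\<^sub>R w) = f v + t *\<^sub>R f w"
      using lin by (simp add: linear_add linear_scale)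
    then have "0 \<le> e * ((v + t *\<^sub>R w) \<bullet> (v + t *\<^sub>R w)) - (f v + t *\<^sub>R f w) \<bullet> (v + t *\<^sub>R w)"
      using le[of "v + t *\<^sub>R w"] by simp
    also have "\<dots> = 2 * t * (e * (v \<bullet> w) - f v \<bullet> w) + t\<^sup>2 * c"
    proof -
      have "(v + t *\<^sub>R w) \<bullet> (v + t *\<^sub>R w) = v \<bullet> v + 2 * t * (v \<bullet> w) + t * t * (w \<bullet> w)"
        by (simp add: inner_add_left inner_add_right inner_commute algebra_simps)
      moreover have "(f v + t *\<^sub>R f w) \<bullet> (v + t *\<^sub>R w) =
          f v \<bullet> v + t * (f v \<bullet> w) + t * (f w \<bullet> v) + t * t * (f w \<bullet> w)"
        by (simp add: inner_add_left inner_add_right algebra_simps)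
      moreover have "f w \<bullet> v = f v \<bullet> w" using adj[of w v] by (simp add: inner_commute)
      moreover have "e * (v \<bullet> v) = f v \<bullet> v" using v1 by (simp add: e_def)
      ultimately show ?thesis
        by (simp add: c_def power2_eq_square algebra_simps)
    qed
    also have "e * (v \<bullet> w) - f v \<bullet> w = w \<bullet> w"
      by (simp add: w_def inner_diff_left)
    finally show ?thesis .
  qed
  \<comment> \<open>The step is negative and so short that the linear term beats the quadratic one;
    \<open>\<bar>c\<bar> + 1\<close> dominates \<open>c\<close> and is never zero. Multiplying by
    its square clears the denominators.\<close>
  from this[of "- (w \<bullet> w) / (\<bar>c\<bar> + 1)"]
  have "0 \<le> (\<bar>c\<bar> + 1)\<^sup>2 * (2 * (- (w \<bullet> w) / (\<bar>c\<bar> + 1)) * (w \<bullet> w) + (- (w \<bullet> w) / (\<bar>c\<bar> + 1))\<^sup>2 * c)"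
    by (intro mult_nonneg_nonneg) simp_all
  moreover have scaled: "d\<^sup>2 * (2 * (- s / d) * s + (- s / d)\<^sup>2 * c) = s\<^sup>2 * (c - 2 * d)" if "d > 0" for s d :: real
    using that by (simp add: power2_eq_square field_simps)
  have "(\<bar>c\<bar> + 1)\<^sup>2 * (2 * (- (w \<bullet> w) / (\<bar>c\<bar> + 1)) * (w \<bullet> w) + (- (w \<bullet> w) / (\<bar>c\<bar> + 1))\<^sup>2 * c) =
      (w \<bullet> w)\<^sup>2 * (c - 2 * (\<bar>c\<bar> + 1))" by (rule scaled) simp
  ultimately have "0 \<le> (w \<bullet> w)\<^sup>2 * (c - 2 * (\<bar>c\<bar> + 1))"
    by (simp only:)
  moreover have "c - 2 * (\<bar>c\<bar> + 1) < 0" by (smt (verit))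
  ultimately have "(w \<bullet> w)\<^sup>2 \<le> 0"
    by (smt (verit) mult_pos_neg)
  then have "f v = e *\<^sub>R v" by (simp add: w_def)
  moreover have "v \<noteq> 0" using v1 by auto
  ultimately show thesis using le that by blast
qed

text \<open>The \<open>Max\<close> in \<open>max_eig\<close> calls for a finite set. One eigenvector
  per eigenvalue gives an orthogonal family of nonzero vectors, and independence bounds its size by
  the dimension.\<close>

lemma finite_self_adjoint_eigenvalues:
  fixes f :: "'a::euclidean_space \<Rightarrow> 'a"
  assumes adj: "\<And>x y. f x \<bullet> y = x \<bullet> f y"
  shows "finite {e. \<exists>v. v \<noteq> 0 \<and> f v = e *\<^sub>R v}" (is "finite ?E")
proof -
  have "\<exists>g. \<forall>e\<in>?E. g e \<noteq> 0 \<and> f (g e) = e *\<^sub>R g e"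
    by (rule bchoice) blast
  then obtain g where g: "\<And>e. e \<in> ?E \<Longrightarrow> g e \<noteq> 0 \<and> f (g e) = e *\<^sub>R g e"
    by blast
  have orth: "g d \<bullet> g e = 0" if "d \<in> ?E" "e \<in> ?E" "d \<noteq> e" for d e
  proof -
    have "d * (g d \<bullet> g e) = e * (g d \<bullet> g e)"
      using adj[of "g d" "g e"] g[OF that(1)] g[OF that(2)] by simp
    then show ?thesis using that(3) by simp
  qed
  have inj: "inj_on g ?E"
  proof (rule inj_onI, rule ccontr)
    fix d e assume "d \<in> ?E" "e \<in> ?E" "g d = g e" "d \<noteq> e"
    then show False using orth[of d e] g[of e] by simp
  qed
  have "pairwise orthogonal (g ` ?E)"
    using orth by (auto simp: pairwise_def orthogonal_def)
  moreover have "0 \<notin> g ` ?E" using g by force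
  ultimately have "finite (g ` ?E)"
    using pairwise_orthogonal_independent independent_bound by blast
  then show ?thesis using inj finite_image_iff by blast
qed

section \<open>Quadratic forms and Rayleigh quotients of Hermitian matrices\<close>

text \<open>This is the double sum inside \<open>psd\<close>. The inner product on complex vectors
  is the real one and sees only its real part; the complex value is kept so that scaling by
  \<open>\<i>\<close> can be followed.\<close>

definition quad_form :: "('n::finite) cmat \<Rightarrow> complex ^ 'n \<Rightarrow> complex" where
  "quad_form M x = (\<Sum>i\<in>UNIV. \<Sum>j\<in>UNIV. cnj (x $ i) * M $ i $ j * x $ j)"

lemma quad_form_add: "quad_form (M + N) x = quad_form M x + quad_form N x"
  by (simp add: quad_form_def algebra_simps sum.distrib)

lemma quad_form_scale: "quad_form (cmat_scale c M) x = c * quad_form M x"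
  by (simp add: quad_form_def cmat_scale_def sum_distrib_left mult_ac)

lemma inner_mult_eq_quad_form: "(M *v x) \<bullet> x = Re (quad_form M x)"
proof -
  have "a \<bullet> b = Re (cnj b * a)" for a b :: complex
    by (simp add: inner_complex_def algebra_simps)
  then have "(M *v x) \<bullet> x = (\<Sum>i\<in>UNIV. Re (cnj (x $ i) * (\<Sum>j\<in>UNIV. M $ i $ j * x $ j)))"
    by (simp add: inner_vec_def matrix_vector_mult_def)
  then show ?thesis by (simp add: quad_form_def sum_distrib_left mult.assoc)
qed

lemma hermitian_cnj: "hermitian M \<Longrightarrow> cnj (M $ i $ j) = M $ j $ i"
  by (metis hermitian_def)

text \<open>Conjugation exchanges the two summation indices.\<close>

lemma hermitian_quad_form_real:
  assumes "hermitian M"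
  shows "Im (quad_form M x) = 0"
proof -
  have "cnj (quad_form M x) = (\<Sum>i\<in>UNIV. \<Sum>j\<in>UNIV. x $ i * cnj (M $ i $ j) * cnj (x $ j))"
    by (simp add: quad_form_def)
  also have "\<dots> = (\<Sum>i\<in>UNIV. \<Sum>j\<in>UNIV. cnj (x $ j) * M $ j $ i * x $ i)"
    by (simp add: hermitian_cnj[OF assms] mult_ac)
  also have "\<dots> = quad_form M x"
    unfolding quad_form_def by (rule sum.swap)
  finally show ?thesis by (simp add: complex_eq_iff)
qed

lemma psd_quad_form_nonneg: "psd M \<Longrightarrow> 0 \<le> Re (quad_form M x)"
  by (simp add: psd_def quad_form_def Let_def)

lemma hermitian_adjoint:
  assumes "hermitian M"
  shows "(M *v x) \<bullet> y = x \<bullet> (M *v y)"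
proof -
  have i: "a \<bullet> b = Re (cnj b * a)" "a \<bullet> b = Re (cnj a * b)" for a b :: complex
    by (simp_all add: inner_complex_def algebra_simps)
  have "(M *v x) \<bullet> y = Re (\<Sum>i\<in>UNIV. \<Sum>j\<in>UNIV. cnj (y $ i) * M $ i $ j * x $ j)"
    by (simp add: inner_vec_def matrix_vector_mult_def i(1) sum_distrib_left mult.assoc)
  also have "\<dots> = Re (cnj (\<Sum>i\<in>UNIV. \<Sum>j\<in>UNIV. cnj (y $ i) * M $ i $ j * x $ j))"
    by (simp only: cnj.sel)
  also have "cnj (\<Sum>i\<in>UNIV. \<Sum>j\<in>UNIV. cnj (y $ i) * M $ i $ j * x $ j) =
      (\<Sum>i\<in>UNIV. \<Sum>j\<in>UNIV. y $ i * cnj (M $ i $ j) * cnj (x $ j))"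
    by simp
  also have "\<dots> = (\<Sum>i\<in>UNIV. \<Sum>j\<in>UNIV. cnj (x $ j) * M $ j $ i * y $ i)"
    by (simp add: hermitian_cnj[OF assms] mult_ac)
  also have "\<dots> = (\<Sum>i\<in>UNIV. \<Sum>j\<in>UNIV. cnj (x $ i) * M $ i $ j * y $ j)"
    by (rule sum.swap)
  also have "Re \<dots> = x \<bullet> (M *v y)"
    by (simp add: inner_vec_def matrix_vector_mult_def i(2) sum_distrib_left mult.assoc)
  finally show ?thesis .
qed

text \<open>Every eigenvalue is the Rayleigh quotient of its eigenvector, so none exceeds the
  maximum of the quotient, which is itself an eigenvalue. Attainment is recorded for the continuity
  proof, which tests at the maximizer.\<close>

lemma max_eig_rayleigh:
  assumes "hermitian M"
  shows "(M *v x) \<bullet> x \<le> max_eig M * (x \<bullet> x)"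
    and "\<exists>v. norm v = 1 \<and> (M *v v) \<bullet> v = max_eig M"
proof -
  have lin: "linear ((*v) M)" by simp
  obtain e v where e: "v \<noteq> 0" "M *v v = e *\<^sub>R v" "\<And>x. (M *v x) \<bullet> x \<le> e * (x \<bullet> x)"
    using self_adjoint_max_eigenvector[OF lin hermitian_adjoint[OF assms]] by metis
  have s: "complex_of_real d *s w = d *\<^sub>R w" for d and w :: "complex ^ 'a"
    by (simp add: vec_eq_iff vector_scalar_mult_def scaleR_conv_of_real[where 'a = complex])
  have "max_eig M = Max {d. \<exists>w. w \<noteq> 0 \<and> M *v w = d *\<^sub>R w}"
    by (simp add: max_eig_def s)
  also have "\<dots> = e"
  proof (rule Max_eqI)
    show "finite {d. \<exists>w. w \<noteq> 0 \<and> M *v w = d *\<^sub>R w}"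
      by (rule finite_self_adjoint_eigenvalues[OF hermitian_adjoint[OF assms]])
    show "e \<in> {d. \<exists>w. w \<noteq> 0 \<and> M *v w = d *\<^sub>R w}" using e by blast
    fix d assume "d \<in> {d. \<exists>w. w \<noteq> 0 \<and> M *v w = d *\<^sub>R w}"
    then obtain w where w: "w \<noteq> 0" "M *v w = d *\<^sub>R w" by blast
    then have "d * (w \<bullet> w) \<le> e * (w \<bullet> w)" using e(3)[of w] by simp
    then show "d \<le> e" using w(1) by simp
  qed
  finally have me: "max_eig M = e" .
  then show "(M *v x) \<bullet> x \<le> max_eig M * (x \<bullet> x)" using e by simp
  have "M *v (v /\<^sub>R norm v) = e *\<^sub>R (v /\<^sub>R norm v)"
    using e(2) lin by (simp add: linear_scale)
  then have "(M *v (v /\<^sub>R norm v)) \<bullet> (v /\<^sub>R norm v) = e * ((v /\<^sub>R norm v) \<bullet> (v /\<^sub>R norm v))"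
    by simp
  moreover have "norm (v /\<^sub>R norm v) = 1" using e(1) by simp
  ultimately show "\<exists>v. norm v = 1 \<and> (M *v v) \<bullet> v = max_eig M"
    by (intro exI[of _ "v /\<^sub>R norm v"]) (metis me norm_eq_1 mult.right_neutral)
qed

text \<open>\<open>max_eig\<close> is Lipschitz on Hermitian matrices: a unit vector attaining
  \<open>max_eig A\<close> is a test vector for \<open>B\<close>, and the roles can be exchanged.
  Continuity makes \<open>max_eig (L t)\<close> an admissible rate in the energy estimate.\<close>

lemma continuous_on_max_eig:
  fixes L :: "'a::topological_space \<Rightarrow> ('n::finite) cmat"
  assumes L: "continuous_on X L" and herm: "\<And>t. t \<in> X \<Longrightarrow> hermitian (L t)"
  shows "continuous_on X (\<lambda>t. max_eig (L t))"
proof -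
  obtain K where K: "K > 0" "\<And>(A::'n cmat) x. norm (A *v x) \<le> norm A * norm x * K"
    using bounded_bilinear.pos_bounded[OF bounded_bilinear_matrix_vector_mult] by blast
  have step: "max_eig A \<le> max_eig B + K * norm (A - B)" if herm: "hermitian A" "hermitian B" for A B :: "'n cmat"
  proof -
    obtain v where v: "norm v = 1" "(A *v v) \<bullet> v = max_eig A"
      using max_eig_rayleigh(2)[OF herm(1)] by blast
    have "(A *v v) \<bullet> v = (B *v v) \<bullet> v + ((A - B) *v v) \<bullet> v"
      by (simp add: matrix_vector_mult_diff_rdistrib inner_diff_left)
    moreover have "(B *v v) \<bullet> v \<le> max_eig B"
      using max_eig_rayleigh(1)[OF herm(2), of v] v(1) by (simp add: norm_eq_1)
    moreover have "((A - B) *v v) \<bullet> v \<le> K * norm (A - B)"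
      using norm_cauchy_schwarz[of "(A - B) *v v" v] K(2)[of "A - B" v] v(1) by (simp add: mult.commute)
    ultimately show ?thesis using v(2) by linarith
  qed
  have "((\<lambda>t. max_eig (L t)) \<longlongrightarrow> max_eig (L s)) (at s within X)" if "s \<in> X" for s
  proof (rule tendsto_sandwich)
    have "((\<lambda>t. L t - L s) \<longlongrightarrow> L s - L s) (at s within X)"
      using L that by (intro tendsto_diff tendsto_const) (simp add: continuous_on_def)
    then have 0: "((\<lambda>t. K * norm (L t - L s)) \<longlongrightarrow> 0) (at s within X)"
      by (intro tendsto_mult_right_zero tendsto_norm_zero) simp
    show "((\<lambda>t. max_eig (L s) - K * norm (L t - L s)) \<longlongrightarrow> max_eig (L s)) (at s within X)"
      using tendsto_diff[OF tendsto_const 0] by simp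
    show "((\<lambda>t. max_eig (L s) + K * norm (L t - L s)) \<longlongrightarrow> max_eig (L s)) (at s within X)"
      using tendsto_add[OF tendsto_const 0] by simp
    show "\<forall>\<^sub>F t in at s within X. max_eig (L t) \<le> max_eig (L s) + K * norm (L t - L s)"
      using step herm that by (auto simp: eventually_at_filter)
    show "\<forall>\<^sub>F t in at s within X. max_eig (L s) - K * norm (L t - L s) \<le> max_eig (L t)"
      using step[of "L s"] herm that
      by (auto simp: eventually_at_filter algebra_simps norm_minus_commute intro!: always_eventually)
  qed
  then show ?thesis by (simp add: continuous_on_def)
qed

section \<open>Interpolation of functions of exponential type\<close>

lemma contour_integral_rectpath_bound:
  assumes cont: "continuous_on (path_image (rectpath a b)) f"
    and bound: "\<And>z. z \<in> path_image (rectpath a b) \<Longrightarrow> norm (f z) \<le> B"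
    and "0 \<le> B" "Re a \<le> Re b" "Im a \<le> Im b"
  shows "norm (contour_integral (rectpath a b) f) \<le> B * (2 * (Re b - Re a) + 2 * (Im b - Im a))"
proof -
  define a2 a4 where "a2 = Complex (Re b) (Im a)" and "a4 = Complex (Re a) (Im b)"
  have rect: "rectpath a b = linepath a a2 +++ linepath a2 b +++ linepath b a4 +++ linepath a4 a"
    by (simp add: rectpath_def a2_def a4_def Let_def)
  have img: "path_image (rectpath a b) = closed_segment a a2 \<union> closed_segment a2 b \<union>
      closed_segment b a4 \<union> closed_segment a4 a"
    by (simp add: rect path_image_join Un_assoc)
  have int: "f contour_integrable_on linepath a a2" "f contour_integrable_on linepath a2 b"
    "f contour_integrable_on linepath b a4" "f contour_integrable_on linepath a4 a"
    using cont unfolding img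
    by (auto intro!: contour_integrable_continuous_linepath intro: continuous_on_subset)
  have "contour_integral (rectpath a b) f = contour_integral (linepath a a2) f +
      contour_integral (linepath a2 b) f + contour_integral (linepath b a4) f +
      contour_integral (linepath a4 a) f"
    using int by (simp add: rect contour_integrable_joinI valid_path_join)
  moreover have "norm (contour_integral (linepath x y) f) \<le> B * norm (y - x)"
    if "f contour_integrable_on linepath x y" "closed_segment x y \<subseteq> path_image (rectpath a b)" for x y
    using that bound \<open>0 \<le> B\<close> by (intro contour_integral_bound_linepath) auto
  then have "norm (contour_integral (linepath a a2) f) \<le> B * norm (a2 - a)"
    "norm (contour_integral (linepath a2 b) f) \<le> B * norm (b - a2)"
    "norm (contour_integral (linepath b a4) f) \<le> B * norm (a4 - b)"
    "norm (contour_integral (linepath a4 a) f) \<le> B * norm (a - a4)"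
    using int img by blast+
  moreover have "norm (a2 - a) = Re b - Re a" "norm (b - a2) = Im b - Im a"
    "norm (a4 - b) = Re b - Re a" "norm (a - a4) = Im b - Im a"
    using assms(4,5) by (auto simp: cmod_def a2_def a4_def)
  ultimately have "norm (contour_integral (rectpath a b) f) \<le>
      B * (Re b - Re a) + B * (Im b - Im a) + B * (Re b - Re a) + B * (Im b - Im a)"
    by (smt (verit) norm_triangle_ineq)
  then show ?thesis by (simp add: algebra_simps)
qed

text \<open>Dividing \<open>h w\<close> by \<open>w - z\<close> leaves the nonzero limit
  \<open>c\<close>. A zero of \<open>g\<close> at \<open>z\<close> is allowed: the singularity is
  then removable and the formula gives \<open>0\<close>.\<close>

lemma residue_quotient_simple_zero:
  assumes S: "open S" "z \<in> S" and hol: "g holomorphic_on S" "h holomorphic_on S"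
    and nz: "\<And>w. w \<in> S \<Longrightarrow> w \<noteq> z \<Longrightarrow> h w \<noteq> 0"
    and "h z = 0" and der: "(h has_field_derivative c) (at z)" and "c \<noteq> 0"
  shows "residue (\<lambda>w. g w / h w) z = g z / c"
proof (rule residue_simple'[OF S])
  show "(\<lambda>w. g w / h w) holomorphic_on S - {z}"
    using hol nz by (intro holomorphic_on_divide) (auto intro: holomorphic_on_subset)
  have "isCont g z"
    using hol(1) S holomorphic_on_imp_continuous_on continuous_on_eq_continuous_at by blast
  then have g: "(g \<longlongrightarrow> g z) (at z)"
    by (simp add: isCont_def)
  have "((\<lambda>w. h w / (w - z)) \<longlongrightarrow> c) (at z)"
    using der \<open>h z = 0\<close> by (simp add: has_field_derivative_iff)
  then have "((\<lambda>w. g w / (h w / (w - z))) \<longlongrightarrow> g z / c) (at z)"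
    by (intro tendsto_divide g \<open>c \<noteq> 0\<close>)
  then show "((\<lambda>w. g w / h w * (w - z)) \<longlongrightarrow> g z / c) (at z)"
    by simp
qed

text \<open>
  The half-integer radius puts the vertical sides of the square where \<open>exp (- 2 pi i a w)\<close> is
  negative real, which keeps the denominator away from zero there.
\<close>

lemma exp_growth_le_on_square:
  fixes w :: complex and a :: real
  assumes "a > 0" and R: "R = (real N + 1/2) / a"
    and w: "\<bar>Re w\<bar> = R \<or> \<bar>Im w\<bar> = R"
  shows "exp (2 * pi * a * max 0 (Im w)) \<le> 2 * norm (exp (- 2 * pi * \<i> * w * of_real a) - 1)"
proof -
  define e where "e = exp (- 2 * pi * \<i> * w * of_real a)"
  define y where "y = 2 * pi * a * Im w"
  have ne: "norm e = exp y"
    by (simp add: e_def y_def norm_exp_eq_Re)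
  have Rpos: "R > 0" "a * R \<ge> 1/2"
    using \<open>a > 0\<close> by (auto simp: R)
  have m: "exp (2 * pi * a * max 0 (Im w)) = max 1 (exp y)"
    using \<open>a > 0\<close> using pi_gt_zero by (auto simp: y_def max_def mult_le_0_iff zero_le_mult_iff simp del: pi_gt_zero)
  from w have "max 1 (exp y) \<le> 2 * norm (e - 1)"
  proof
    assume x: "\<bar>Re w\<bar> = R"
    have "cos (2 * pi * (Re w * a)) = cos (2 * pi * \<bar>Re w * a\<bar>)"
      by (simp add: abs_if)
    also have "\<bar>Re w * a\<bar> = real N + 1/2"
      using x R \<open>a > 0\<close> by (simp add: abs_mult)
    also have "cos (2 * pi * (real N + 1/2)) = cos (real (2 * N + 1) * pi)"
      by (simp add: algebra_simps)
    also have "\<dots> = -1"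
      by (simp only: cos_npi) simp
    finally have c: "cos (2 * pi * (Re w * a)) = -1" .
    have "Re e = - exp y"
      using c by (simp add: e_def y_def Re_exp algebra_simps)
    moreover have "\<bar>Re (e - 1)\<bar> \<le> norm (e - 1)"
      by (rule abs_Re_le_cmod)
    ultimately have "norm (e - 1) \<ge> exp y + 1"
      by simp
    then show ?thesis using exp_gt_zero[of y] by linarith
  next
    assume "\<bar>Im w\<bar> = R"
    then have "\<bar>y\<bar> \<ge> pi"
      using Rpos \<open>a > 0\<close> by (simp add: y_def abs_mult)
    \<comment> \<open>With \<open>\<bar>y\<bar> \<ge> 1\<close>, the inequality
      \<open>exp x \<ge> 1 + x\<close> puts \<open>exp y\<close> above \<open>2\<close> or below
      \<open>1/2\<close>; this is what the factor \<open>2\<close> in the claim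
      accommodates.\<close>
    then have "y \<ge> 1 \<or> y \<le> -1"
      using pi_gt3 by linarith
    then show ?thesis
    proof
      assume "y \<ge> 1"
      then have "exp y \<ge> 2" using exp_ge_add_one_self[of y] by linarith
      moreover have "norm (e - 1) \<ge> exp y - 1"
        using norm_triangle_ineq2[of e 1] ne by simp
      ultimately show ?thesis by simp
    next
      assume "y \<le> -1"
      then have "exp (-y) \<ge> 2" using exp_ge_add_one_self[of "-y"] by linarith
      then have "exp y \<le> 1/2" by (simp add: exp_minus field_simps)
      moreover have "norm (e - 1) \<ge> 1 - exp y"
        using norm_triangle_ineq2[of 1 e] ne by (simp add: norm_minus_commute)
      ultimately show ?thesis by simp
    qed
  qed
  then show ?thesis using m by (simp add: e_def)
qed

text \<open>\<open>R0\<close> makes \<open>norm w / 2\<close> at least \<open>1\<close> and at least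
  every \<open>norm (p r)\<close>, so each of the \<open>m + 1\<close> linear factors has norm at
  least \<open>norm w / 2\<close>. As this number is at least \<open>1\<close>, two factors suffice
  for the quadratic bound, and the two halvings give the \<open>4\<close> in
  \<open>\<kappa>\<close>.\<close>

lemma interpolation_denominator_lower_bound:
  fixes p :: "nat \<Rightarrow> complex"
  assumes "m \<ge> 1" and "\<forall>r\<in>{1..m}. p r \<noteq> - \<i>"
  obtains R0 \<kappa> where "R0 > 0" "\<kappa> > 0"
    "\<And>w. norm w \<ge> R0 \<Longrightarrow>
      norm ((w + \<i>) * (\<Prod>r\<in>{1..m}. (w - p r) / (- \<i> - p r))) \<ge> \<kappa> * (norm w)\<^sup>2"
proof
  define R0 where "R0 = 2 * (1 + (\<Sum>r\<in>{1..m}. norm (p r)))"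
  define \<kappa> where "\<kappa> = (\<Prod>r\<in>{1..m}. 1 / norm (- \<i> - p r)) / 4"
  have s: "(\<Sum>r\<in>{1..m}. norm (p r)) \<ge> 0" by (intro sum_nonneg) auto
  then show "R0 > 0" by (simp add: R0_def)
  have nz: "norm (- \<i> - p r) > 0" if "r \<in> {1..m}" for r
    using assms that by auto
  then show "\<kappa> > 0"
    unfolding \<kappa>_def by (intro divide_pos_pos prod_pos) auto
  fix w :: complex assume w: "norm w \<ge> R0"
  define x where "x = norm w / 2"
  have x: "x \<ge> 1" using w s by (simp add: x_def R0_def)
  have i: "norm (w + \<i>) \<ge> x"
    using norm_triangle_ineq2[of w "-\<i>"] w s by (simp add: x_def R0_def)
  have f: "norm (w - p r) \<ge> x" if "r \<in> {1..m}" for r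
  proof -
    have "norm (p r) \<le> (\<Sum>r\<in>{1..m}. norm (p r))"
      using that by (intro member_le_sum) auto
    then show ?thesis
      using norm_triangle_ineq2[of w "p r"] w by (simp add: x_def R0_def)
  qed
  have "x \<le> x ^ m"
    using x \<open>m \<ge> 1\<close> power_increasing[of 1 m x] by simp
  also have "x ^ m = (\<Prod>r\<in>{1..m}. x)" by simp
  also have "\<dots> \<le> (\<Prod>r\<in>{1..m}. norm (w - p r))"
    using f x by (intro prod_mono) auto
  finally have "x * x \<le> norm (w + \<i>) * (\<Prod>r\<in>{1..m}. norm (w - p r))"
    using i x by (intro mult_mono) auto
  then have "(\<Prod>r\<in>{1..m}. 1 / norm (- \<i> - p r)) * (x * x) \<le>
      (\<Prod>r\<in>{1..m}. 1 / norm (- \<i> - p r)) * (norm (w + \<i>) * (\<Prod>r\<in>{1..m}. norm (w - p r)))"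
    by (intro mult_left_mono prod_nonneg) auto
  moreover have "norm ((w + \<i>) * (\<Prod>r\<in>{1..m}. (w - p r) / (- \<i> - p r))) =
      (\<Prod>r\<in>{1..m}. 1 / norm (- \<i> - p r)) * (norm (w + \<i>) * (\<Prod>r\<in>{1..m}. norm (w - p r)))"
    by (simp only: norm_mult norm_divide prod_dividef prod_norm[symmetric]) simp
  moreover have "(\<Prod>r\<in>{1..m}. 1 / norm (- \<i> - p r)) * (x * x) = \<kappa> * (norm w)\<^sup>2"
    by (simp add: \<kappa>_def x_def power2_eq_square)
  ultimately show "norm ((w + \<i>) * (\<Prod>r\<in>{1..m}. (w - p r) / (- \<i> - p r))) \<ge> \<kappa> * (norm w)\<^sup>2"
    by simp
qed

section \<open>Sums over the integers\<close>

text \<open>The rays for \<open>s = 1\<close> and \<open>s = -1\<close> cover the integers; they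
  overlap at \<open>0\<close>, which summability tolerates.\<close>

lemma summable_on_int_if_quadratic_decay:
  fixes f :: "int \<Rightarrow> complex"
  assumes "\<And>k. \<bar>k\<bar> \<ge> k0 \<Longrightarrow> norm (f k) \<le> C / (real_of_int k)\<^sup>2"
  shows "f summable_on UNIV"
proof -
  have half: "(\<lambda>n. f (s * int n)) summable_on UNIV" if s: "\<bar>s\<bar> = 1" for s
  proof (rule norm_summable_imp_summable_on, rule summable_comparison_test_ev)
    show "summable (\<lambda>n. C * (1 / (real n)\<^sup>2))"
      using inverse_power_summable[of 2, where 'a=real] by (intro summable_mult) (simp add: field_simps)
    have "norm (norm (f (s * int n))) \<le> C * (1 / (real n)\<^sup>2)" if "n \<ge> nat k0" for n
    proof -
      have "(real_of_int (s * int n))\<^sup>2 = (real n)\<^sup>2"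
        using s by (simp add: abs_if split: if_splits)
      moreover have "\<bar>s * int n\<bar> \<ge> k0" using s that by (simp add: abs_mult)
      ultimately show ?thesis using assms[of "s * int n"] by simp
    qed
    then show "\<forall>\<^sub>F n in sequentially. norm (norm (f (s * int n))) \<le> C * (1 / (real n)\<^sup>2)"
      using eventually_sequentially by blast
  qed
  have "f summable_on (range (\<lambda>n. s * int n))" if s: "\<bar>s\<bar> = 1" for s
    using half[OF s] s by (subst summable_on_reindex) (auto simp: inj_on_def o_def)
  then have "f summable_on (range (\<lambda>n. 1 * int n) \<union> range (\<lambda>n. -1 * int n))"
    by (intro summable_on_union) (simp_all only: abs_one abs_minus_cancel)
  moreover have "range (\<lambda>n. 1 * int n) \<union> range (\<lambda>n. -1 * int n) = UNIV"
    by (auto simp: image_iff) (metis int_cases2)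
  ultimately show ?thesis by simp
qed

text \<open>Unconditional summation is a limit along finite sets, and the symmetric intervals, which
  are the index sets cut out by the squares, eventually contain any given one.\<close>

lemma has_sum_int_symmetric_limit:
  fixes f :: "int \<Rightarrow> 'a::{comm_monoid_add,topological_space}"
  assumes "(f has_sum S) UNIV"
  shows "(\<lambda>N. \<Sum>k\<in>{- int N..int N}. f k) \<longlonglongrightarrow> S"
proof -
  have "filterlim (\<lambda>N. {- int N..int N}) (finite_subsets_at_top UNIV) sequentially"
    unfolding filterlim_finite_subsets_at_top
  proof (intro allI impI)
    fix X :: "int set" assume X: "finite X \<and> X \<subseteq> UNIV"
    define B where "B = nat (\<Sum>k\<in>X. \<bar>k\<bar>)"
    have "\<bar>k\<bar> \<le> int B" if "k \<in> X" for k
      using member_le_sum[OF that, of abs] X by (simp add: B_def)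
    then have "X \<subseteq> {- int N..int N}" if "N \<ge> B" for N
      using that by (force simp: abs_le_iff)
    then show "\<forall>\<^sub>F N in sequentially. finite {- int N..int N} \<and> X \<subseteq> {- int N..int N} \<and> {- int N..int N} \<subseteq> UNIV"
      using eventually_sequentially by auto
  qed
  then show ?thesis
    using assms unfolding has_sum_def by (rule filterlim_compose[rotated])
qed

text \<open>The scalar core, applied later to every entry of \<open>U\<close>. The coefficients
  already have the shape of the matrix statement so that they transfer verbatim.\<close>

theorem exponential_type_sampling:
  fixes u :: "complex \<Rightarrow> complex" and a K :: real and p :: "nat \<Rightarrow> complex"
  assumes "a > 0" and u: "u holomorphic_on UNIV"
    and growth: "\<And>z. norm (u z) \<le> K * exp (2 * pi * a * max 0 (Im z))"
    and "m \<ge> 1" and inj: "inj_on p {1..m}"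
    and p_neq: "\<forall>r\<in>{1..m}. p r \<noteq> - \<i>"
    and p_nint: "\<forall>r\<in>{1..m}. \<forall>k::int. p r \<noteq> of_int k / of_real a"
  shows "\<exists>S. ((\<lambda>k::int. (exp (- 2 * pi * a) - 1) /
               (2 * pi * \<i> * (of_int k / of_real a + \<i>) *
                (\<Prod>r\<in>{1..m}. (of_int k / of_real a - p r) / (- \<i> - p r))) *
              u (of_int k / of_real a)) has_sum S) UNIV \<and>
         u (- \<i>) - 1 / of_real a * S -
         (\<Sum>r\<in>{1..m}. (exp (- 2 * pi * a) - 1) /
                 ((exp (- 2 * pi * \<i> * p r * of_real a) - 1) *
                  (\<Prod>r'\<in>{1..m} - {r}. (p r - p r') / (- \<i> - p r'))) * u (p r)) = 0"
proof -
  define E where "E w = exp (- 2 * pi * \<i> * w * of_real a) - 1" for w :: complex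
  define P where "P w = (\<Prod>r\<in>{1..m}. (w - p r) / (- \<i> - p r))" for w
  define D where "D w = (w + \<i>) * P w" for w
  define f where "f w = u w / (E w * D w)" for w
  define c :: complex where "c = exp (- 2 * pi * a) - 1"
  define q :: "int \<Rightarrow> complex" where "q k = of_int k / of_real a" for k
  define t where "t k = c / (2 * pi * \<i> * D (q k)) * u (q k)" for k
  define s where "s r = c / (E (p r) * (\<Prod>r'\<in>{1..m} - {r}. (p r - p r') / (- \<i> - p r'))) * u (p r)" for r

  have K: "K \<ge> 0" using growth[of 0] by (smt (verit) exp_gt_zero mult_neg_pos norm_ge_zero)
  have cE: "c = E (- \<i>)"
  proof -
    have "- 2 * pi * \<i> * (- \<i>) * of_real a = complex_of_real (- 2 * pi * a)"
      by (simp add: complex_eq_iff)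
    then show ?thesis by (simp only: c_def E_def) (simp flip: exp_of_real)
  qed
  have c0: "c \<noteq> 0"
  proof -
    have "exp (- 2 * pi * a) < 1" using \<open>a > 0\<close> by simp
    then show ?thesis by (auto simp: c_def complex_eq_iff)
  qed
  have holo: "E holomorphic_on X" "P holomorphic_on X" "D holomorphic_on X" "u holomorphic_on X" for X
    unfolding E_def P_def D_def using p_neq
    by (auto intro!: holomorphic_intros intro: holomorphic_on_subset[OF u])
  have E0: "E w = 0 \<longleftrightarrow> w \<in> range q" for w
  proof -
    have "E w = 0 \<longleftrightarrow> Im w = 0 \<and> (\<exists>n::int. - (2 * pi * Re w * a) = of_int (2 * n) * pi)"
      using \<open>a > 0\<close> by (simp add: E_def exp_eq_1 mult.commute mult.left_commute)
    also have "(\<exists>n::int. - (2 * pi * Re w * a) = of_int (2 * n) * pi) \<longleftrightarrow> (\<exists>n::int. Re w = of_int n / a)"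
    proof
      assume "\<exists>n::int. - (2 * pi * Re w * a) = of_int (2 * n) * pi"
      then obtain n :: int where "- (2 * pi * Re w * a) = of_int (2 * n) * pi" ..
      then have "pi * (Re w * a) = pi * (- of_int n)" by (simp add: algebra_simps)
      then have "Re w * a = - of_int n" using pi_neq_zero mult_left_cancel by blast
      then have "Re w = of_int (- n) / a" using \<open>a > 0\<close> by (simp add: field_simps)
      then show "\<exists>n::int. Re w = of_int n / a" by blast
    next
      assume "\<exists>n::int. Re w = of_int n / a"
      then obtain n :: int where "Re w = of_int n / a" ..
      then have "- (2 * pi * Re w * a) = of_int (2 * (- n)) * pi" using \<open>a > 0\<close> by simp
      then show "\<exists>n::int. - (2 * pi * Re w * a) = of_int (2 * n) * pi" by blast
    qed
    also have "Im w = 0 \<and> (\<exists>n::int. Re w = of_int n / a) \<longleftrightarrow> w \<in> range q"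
      by (auto simp: q_def complex_eq_iff image_iff Re_divide_of_real Im_divide_of_real)
    finally show ?thesis .
  qed
  have D0: "D w = 0 \<longleftrightarrow> w = - \<i> \<or> w \<in> p ` {1..m}" for w
  proof -
    have "P w = 0 \<longleftrightarrow> (\<exists>r\<in>{1..m}. (w - p r) / (- \<i> - p r) = 0)"
      unfolding P_def by (rule prod_zero_iff) simp
    also have "\<dots> \<longleftrightarrow> (\<exists>r\<in>{1..m}. w = p r)"
    proof (rule bex_cong[OF refl])
      fix r assume "r \<in> {1..m}"
      then have "- \<i> - p r \<noteq> 0" using p_neq by (metis right_minus_eq)
      then show "(w - p r) / (- \<i> - p r) = 0 \<longleftrightarrow> w = p r" by simp
    qed
    finally show ?thesis by (auto simp: D_def eq_neg_iff_add_eq_0)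
  qed
  have i_nq: "- \<i> \<notin> range q"
    by (auto simp: q_def complex_eq_iff)
  have p_nq: "p r \<notin> range q" if "r \<in> {1..m}" for r
    using p_nint that by (auto simp: q_def)
  have q_real: "q k = of_real (of_int k / a)" for k
    by (simp add: q_def)
  have q_inj: "inj q" using \<open>a > 0\<close> by (auto simp: inj_on_def q_def)

  obtain R0 \<kappa> where R0: "R0 > 0" "\<kappa> > 0"
    and lower: "\<And>w. norm w \<ge> R0 \<Longrightarrow> norm (D w) \<ge> \<kappa> * (norm w)\<^sup>2"
    using interpolation_denominator_lower_bound[OF \<open>m \<ge> 1\<close> p_neq] unfolding D_def P_def by metis

  have "t summable_on UNIV"
  proof (rule summable_on_int_if_quadratic_decay)
    \<comment> \<open>Beyond this threshold \<open>norm (q k) \<ge> R0\<close>, so the lower bound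
      for \<open>D\<close> applies, and \<open>k\<close> is nonzero.\<close>
    fix k :: int assume k: "\<lceil>R0 * a\<rceil> + 1 \<le> \<bar>k\<bar>"
    have nq: "norm (q k) = \<bar>of_int k\<bar> / a"
      using \<open>a > 0\<close> by (simp add: q_def norm_divide)
    have "R0 * a \<le> \<bar>of_int k\<bar>" using k by linarith
    then have "norm (q k) \<ge> R0" using \<open>a > 0\<close> by (simp add: nq field_simps)
    then have D: "norm (D (q k)) \<ge> \<kappa> * (\<bar>of_int k\<bar> / a)\<^sup>2" using lower[of "q k"] nq by simp
    have "R0 * a > 0" using R0 \<open>a > 0\<close> by simp
    then have k0: "k \<noteq> 0" using \<open>R0 * a \<le> \<bar>of_int k\<bar>\<close> by auto
    then have pos: "\<kappa> * (\<bar>of_int k\<bar> / a)\<^sup>2 > 0" using R0 \<open>a > 0\<close> by simp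
    have uK: "norm (u (q k)) \<le> K" using growth[of "q k"] \<open>a > 0\<close> by (simp add: q_def)
    have "norm (t k) = norm c * norm (u (q k)) / (2 * pi * norm (D (q k)))"
      by (simp add: t_def norm_mult norm_divide)
    also have "\<dots> \<le> norm c * K / (2 * pi * (\<kappa> * (\<bar>of_int k\<bar> / a)\<^sup>2))"
    proof (rule frac_le)
      show "norm c * norm (u (q k)) \<le> norm c * K" using uK by (intro mult_left_mono) auto
      show "2 * pi * (\<kappa> * (\<bar>of_int k\<bar> / a)\<^sup>2) \<le> 2 * pi * norm (D (q k))"
        using D by (intro mult_left_mono) auto
    qed (use pos K in auto)
    also have "\<dots> = (norm c * K * a\<^sup>2 / (2 * pi * \<kappa>)) / (of_int k)\<^sup>2"
      using k0 by (simp add: field_simps power_divide)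
    finally show "norm (t k) \<le> (norm c * K * a\<^sup>2 / (2 * pi * \<kappa>)) / (real_of_int k)\<^sup>2" .
  qed
  then obtain S where S: "(t has_sum S) UNIV"
    by (auto simp: summable_on_def)

  define R where "R N = (real N + 1/2) / a" for N
  define \<gamma> where "\<gamma> N = rectpath (- Complex (R N) (R N)) (Complex (R N) (R N))" for N
  have Rpos: "R N > 0" for N using \<open>a > 0\<close> by (simp add: R_def)
  have Rlim: "filterlim R at_top sequentially"
  proof -
    have "filterlim (\<lambda>N. 1 / a * (1/2 + real N)) at_top sequentially"
      using \<open>a > 0\<close>
      by (intro filterlim_tendsto_pos_mult_at_top[OF tendsto_const] filterlim_real_sequentially
          filterlim_tendsto_add_at_top[OF tendsto_const]) simp
    moreover have "R = (\<lambda>N. 1 / a * (1/2 + real N))"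
      by (simp add: R_def fun_eq_iff add.commute)
    ultimately show ?thesis by simp
  qed
  have imgR: "\<bar>Re w\<bar> = R N \<or> \<bar>Im w\<bar> = R N" "\<bar>Re w\<bar> \<le> R N" "\<bar>Im w\<bar> \<le> R N"
    if "w \<in> path_image (\<gamma> N)" for w N
    using that Rpos[of N] by (auto simp: \<gamma>_def path_image_rectpath)
  \<comment> \<open>A zero of \<open>E\<close> on the square would bound a positive exponential by
    \<open>0\<close>.\<close>
  have imgE: "E w \<noteq> 0" if "w \<in> path_image (\<gamma> N)" for w N
    using exp_growth_le_on_square[OF \<open>a > 0\<close> R_def imgR(1)[OF that]]
    by (auto simp: E_def)
  have fbound: "norm (f w) \<le> 2 * K / (\<kappa> * (R N)\<^sup>2)"
    if w: "w \<in> path_image (\<gamma> N)" and N: "R N \<ge> R0" for w N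
  proof -
    have "norm w \<ge> R N"
      using imgR(1)[OF w] abs_Re_le_cmod[of w] abs_Im_le_cmod[of w] by linarith
    then have "\<kappa> * (R N)\<^sup>2 \<le> \<kappa> * (norm w)\<^sup>2"
      using R0 Rpos[of N] by (intro mult_left_mono power_mono) auto
    also have "\<dots> \<le> norm (D w)" using lower[of w] \<open>norm w \<ge> R N\<close> N by simp
    finally have D: "norm (D w) \<ge> \<kappa> * (R N)\<^sup>2" .
    have pos: "\<kappa> * (R N)\<^sup>2 > 0" using R0 Rpos[of N] by simp
    have "norm (u w) \<le> K * exp (2 * pi * a * max 0 (Im w))" by (rule growth)
    also have "\<dots> \<le> K * (2 * norm (E w))"
      unfolding E_def using K exp_growth_le_on_square[OF \<open>a > 0\<close> R_def imgR(1)[OF w]]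
      by (intro mult_left_mono) auto
    finally have "norm (u w) / norm (E w) \<le> 2 * K"
      using imgE[OF w] by (simp add: field_simps)
    then have "norm (u w) / norm (E w) / norm (D w) \<le> 2 * K / (\<kappa> * (R N)\<^sup>2)"
      using D pos K by (intro frac_le) auto
    then show ?thesis by (simp add: f_def norm_mult norm_divide field_simps)
  qed
  have imgD: "D w \<noteq> 0" if w: "w \<in> path_image (\<gamma> N)" and N: "R N \<ge> R0" for w N
  proof -
    have "norm w \<ge> R N"
      using imgR(1)[OF w] abs_Re_le_cmod[of w] abs_Im_le_cmod[of w] by linarith
    then have "norm w \<ge> R0" "norm w > 0" using N R0 by auto
    then have "\<kappa> * (norm w)\<^sup>2 > 0" "norm (D w) \<ge> \<kappa> * (norm w)\<^sup>2"
      using lower[of w] R0 by auto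
    then show ?thesis by auto
  qed
  \<comment> \<open>The perimeter \<open>8 * R N\<close> times the pointwise bound gives the
    constant \<open>16\<close>.\<close>
  have integral_bound: "norm (contour_integral (\<gamma> N) f) \<le> 16 * K / \<kappa> / R N" if N: "R N \<ge> R0" for N
  proof -
    have "continuous_on (path_image (\<gamma> N)) f"
      unfolding f_def
      using imgE imgD[OF _ N] holo[THEN holomorphic_on_imp_continuous_on]
      by (intro continuous_intros) auto
    then have "norm (contour_integral (\<gamma> N) f) \<le> 2 * K / (\<kappa> * (R N)\<^sup>2) *
        (2 * (Re (Complex (R N) (R N)) - Re (- Complex (R N) (R N))) +
         2 * (Im (Complex (R N) (R N)) - Im (- Complex (R N) (R N))))"
      unfolding \<gamma>_def using fbound[OF _ N] K R0 Rpos[of N]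
      by (intro contour_integral_rectpath_bound) (auto simp: \<gamma>_def)
    also have "\<dots> = 16 * K / \<kappa> / R N"
      using R0 Rpos[of N] by (simp add: field_simps power2_eq_square)
    finally show ?thesis .
  qed
  have integral_lim: "(\<lambda>N. contour_integral (\<gamma> N) f) \<longlonglongrightarrow> 0"
  proof (rule Lim_null_comparison)
    show "\<forall>\<^sub>F N in sequentially. norm (contour_integral (\<gamma> N) f) \<le> 16 * K / \<kappa> / R N"
      using Rlim[unfolded filterlim_at_top, rule_format, of R0]
      by eventually_elim (rule integral_bound)
    show "(\<lambda>N. 16 * K / \<kappa> / R N) \<longlonglongrightarrow> 0"
      by (rule tendsto_divide_0[OF tendsto_const filterlim_at_top_imp_at_infinity[OF Rlim]])
  qed

  have residues: "c / (2 * pi * \<i>) * contour_integral (\<gamma> N) f =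
      u (- \<i>) - 1 / of_real a * (\<Sum>k\<in>{- int N..int N}. t k) - (\<Sum>r\<in>{1..m}. s r)"
    if N: "R N \<ge> R0" for N
  proof -
    define pts where "pts = q ` {- int N..int N} \<union> {- \<i>} \<union> p ` {1..m}"
    text \<open>A box slightly larger than the contour, which contains no poles outside the contour.\<close>
    define R' where "R' = (real N + 3/4) / a"
    define B where "B = box (- Complex R' R') (Complex R' R')"
    have RR': "R N < R'" using \<open>a > 0\<close> by (simp add: R_def R'_def divide_strict_right_mono)
    \<comment> \<open>Beyond \<open>R0\<close> the lower bound excludes zeros of \<open>D\<close>,
      so all of them lie inside the contour without comparing each \<open>p r\<close> with
      \<open>R N\<close>.\<close>
    have D_small: "norm w < R N" if "D w = 0" for w
    proof (rule ccontr)
      assume "\<not> norm w < R N"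
      then have "norm w \<ge> R0" "norm w > 0" using N R0 by auto
      then have "\<kappa> * (norm w)\<^sup>2 > 0" "norm (D w) \<ge> \<kappa> * (norm w)\<^sup>2"
        using lower[of w] R0 by auto
      then show False using that by auto
    qed
    have q_in: "q k \<in> box (- Complex (R N) (R N)) (Complex (R N) (R N))"
      if "k \<in> {- int N..int N}" for k
    proof -
      have lt: "x / a < y / a" if "x < y" for x y
        using that \<open>a > 0\<close> by (rule divide_strict_right_mono)
      have k: "real_of_int k < real N + 1/2" "- real_of_int k < real N + 1/2"
        using that by auto
      have "real_of_int k / a < R N" "- real_of_int k / a < R N"
        using lt[OF k(1)] lt[OF k(2)] by (simp_all only: R_def)
      then show ?thesis using Rpos[of N]
        by (simp add: in_box_complex_iff q_real)
    qed
    have D_in: "w \<in> box (- Complex (R N) (R N)) (Complex (R N) (R N))" if "D w = 0" for w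
      using D_small[OF that] abs_Re_le_cmod[of w] abs_Im_le_cmod[of w]
      by (auto simp: in_box_complex_iff)
    \<comment> \<open>Here \<open>3/4 < 1\<close> matters: an integer of absolute value below
      \<open>N + 3/4\<close> is at most \<open>N\<close> in absolute value.\<close>
    have q_out: "k \<in> {- int N..int N}" if "q k \<in> B" for k
    proof -
      have "\<bar>real_of_int k\<bar> < real N + 3/4"
      proof -
        have "real_of_int k / a < (real N + 3/4) / a" "- (real_of_int k / a) < (real N + 3/4) / a"
          using that by (simp_all add: B_def in_box_complex_iff q_real R'_def)
        then have "real_of_int k / a < (real N + 3/4) / a" "(- real_of_int k) / a < (real N + 3/4) / a"
          by simp_all
        then show ?thesis using \<open>a > 0\<close> by (simp only: divide_less_cancel) auto
      qed
      then show ?thesis by auto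
    qed
    have box_sub: "box (- Complex (R N) (R N)) (Complex (R N) (R N)) \<subseteq> B"
      using RR' by (auto simp: B_def in_box_complex_iff)
    have pts_in: "pts \<subseteq> box (- Complex (R N) (R N)) (Complex (R N) (R N))"
      using q_in D_in D0 by (auto simp: pts_def)
    have zeros: "w \<in> pts" if "w \<in> B" "E w * D w = 0" for w
      using that E0[of w] D0[of w] q_out by (auto simp: pts_def)
    have pts_zero: "E w * D w = 0" if "w \<in> pts" for w
      using that E0[of w] D0[of w] by (auto simp: pts_def)
    have "finite pts" by (simp add: pts_def)
    have "open B" "connected B" by (auto simp: B_def intro: convex_connected)
    have img_sub: "path_image (\<gamma> N) \<subseteq> B - pts"
    proof
      fix w assume w: "w \<in> path_image (\<gamma> N)"
      have "w \<notin> pts" using pts_zero imgE[OF w] imgD[OF w N] by auto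
      moreover have "w \<in> B" using imgR[OF w] RR' by (auto simp: B_def in_box_complex_iff)
      ultimately show "w \<in> B - pts" by simp
    qed
    have fin_holo: "f holomorphic_on B - pts"
      unfolding f_def using zeros holo by (intro holomorphic_intros) auto
    have "winding_number (\<gamma> N) w = 0" if "w \<notin> B" for w
      unfolding \<gamma>_def using that RR' Rpos[of N]
      by (intro winding_number_rectpath_outside) (auto simp: B_def in_box_complex_iff in_cbox_complex_iff)
    then have "contour_integral (\<gamma> N) f = 2 * pi * \<i> * (\<Sum>w\<in>pts. winding_number (\<gamma> N) w * residue f w)"
      using \<open>open B\<close> \<open>connected B\<close> \<open>finite pts\<close> fin_holo img_sub
      by (intro Residue_theorem[of B]) (auto simp: \<gamma>_def)
    also have "(\<Sum>w\<in>pts. winding_number (\<gamma> N) w * residue f w) = (\<Sum>w\<in>pts. residue f w)"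
      using pts_in by (intro sum.cong) (auto simp: \<gamma>_def winding_number_rectpath subsetD)
    also have "\<dots> = (\<Sum>k\<in>{- int N..int N}. residue f (q k)) + residue f (- \<i>) + (\<Sum>r\<in>{1..m}. residue f (p r))"
    proof -
      have "(\<Sum>w\<in>pts. residue f w) = (\<Sum>w\<in>q ` {- int N..int N}. residue f w) + residue f (- \<i>) +
          (\<Sum>w\<in>p ` {1..m}. residue f w)"
      proof -
        have "q ` {- int N..int N} \<inter> {- \<i>} = {}" using i_nq by (auto simp: image_iff)
        moreover have "(q ` {- int N..int N} \<union> {- \<i>}) \<inter> p ` {1..m} = {}"
        proof (rule equals0I)
          fix w assume "w \<in> (q ` {- int N..int N} \<union> {- \<i>}) \<inter> p ` {1..m}"
          then have w: "w \<in> q ` {- int N..int N} \<union> {- \<i>}" and "w \<in> p ` {1..m}"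
            by (rule IntD1, rule IntD2)
          then obtain r where r: "r \<in> {1..m}" "w = p r"
            by (elim imageE)
          from w have "w \<in> range q \<or> w = - \<i>" by auto
          then show False using p_nq[OF r(1)] p_neq r by auto
        qed
        ultimately show ?thesis unfolding pts_def by (simp only: sum.union_disjoint finite_Un finite_imageI
              finite_atLeastAtMost finite_atLeastAtMost_int finite.intros simp_thms) simp
      qed
      also have "(\<Sum>w\<in>q ` {- int N..int N}. residue f w) = (\<Sum>k\<in>{- int N..int N}. residue f (q k))"
        using q_inj by (subst sum.reindex) (auto intro: inj_on_subset)
      also have "(\<Sum>w\<in>p ` {1..m}. residue f w) = (\<Sum>r\<in>{1..m}. residue f (p r))"
        using inj by (subst sum.reindex) auto
      finally show ?thesis .
    qed
    finally have main: "contour_integral (\<gamma> N) f = 2 * pi * \<i> * ((\<Sum>k\<in>{- int N..int N}. residue f (q k)) +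
        residue f (- \<i>) + (\<Sum>r\<in>{1..m}. residue f (p r)))" .

    have simple: "residue f z = u z / d"
      if "z \<in> pts" "((\<lambda>w. E w * D w) has_field_derivative d) (at z)" "d \<noteq> 0" for z d
    proof -
      \<comment> \<open>Removing the other poles leaves a neighbourhood in which \<open>z\<close> is
        the only zero of the denominator.\<close>
      have op: "open (B - (pts - {z}))"
        using \<open>open B\<close> \<open>finite pts\<close> by (intro open_Diff finite_imp_closed) auto
      have mem: "z \<in> B - (pts - {z})" using that(1) pts_in box_sub by auto
      have hol: "(\<lambda>w. E w * D w) holomorphic_on B - (pts - {z})"
        by (intro holomorphic_on_mult holo)
      have nz: "E w * D w \<noteq> 0" if "w \<in> B - (pts - {z})" "w \<noteq> z" for w
        using that zeros by blast
      show ?thesis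
        unfolding f_def
      proof (rule residue_quotient_simple_zero[OF op mem _ hol])
        show "u holomorphic_on B - (pts - {z})" by (rule holo(4))
        show "((\<lambda>w. E w * D w) has_field_derivative d) (at z)" by (rule that(2))
      qed (fact nz pts_zero[OF that(1)] that(3))+
    qed
    have derE: "(E has_field_derivative (- 2 * pi * \<i> * of_real a) * exp (- 2 * pi * \<i> * w * of_real a)) (at w)" for w
      unfolding E_def by (auto intro!: derivative_eq_intros)
    have derD: "(D has_field_derivative deriv D w) (at w)" and derP: "(P has_field_derivative deriv P w) (at w)"
      and derE': "(E has_field_derivative deriv E w) (at w)" for w
      using holo[of UNIV] by (auto intro!: holomorphic_derivI)
    \<comment> \<open>Since \<open>E\<close> vanishes at \<open>q k\<close>, the product rule keeps
      only the derivative of \<open>E\<close> times \<open>D\<close>. The value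
      \<open>- 2 * pi * \<i> * a\<close> of that derivative accounts for the sign, the
      \<open>1 / a\<close> and the \<open>2 * pi * \<i>\<close> inside \<open>t\<close>.\<close>
    have res_q: "c * residue f (q k) = - (1 / of_real a * t k)" if "k \<in> {- int N..int N}" for k
    proof -
      have Eq: "E (q k) = 0" using E0 by blast
      then have e1: "exp (- 2 * pi * \<i> * q k * of_real a) = 1" by (simp add: E_def)
      have Dq: "D (q k) \<noteq> 0" using D0[of "q k"] i_nq p_nq by (metis imageE rangeI)
      have "((\<lambda>w. E w * D w) has_field_derivative (- 2 * pi * \<i> * of_real a) * D (q k)) (at (q k))"
        using DERIV_mult[OF derE[of "q k"] derD[of "q k"]] by (simp only: e1 Eq) simp
      then have "residue f (q k) = u (q k) / ((- 2 * pi * \<i> * of_real a) * D (q k))"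
        using that Dq \<open>a > 0\<close> by (intro simple) (auto simp: pts_def)
      then show ?thesis using Dq \<open>a > 0\<close> by (simp add: t_def mult_ac)
    qed
    have res_i: "c * residue f (- \<i>) = u (- \<i>)"
    proof -
      have P1: "P (- \<i>) = 1" unfolding P_def using p_neq by (intro prod.neutral) auto
      have D1: "(D has_field_derivative 1) (at (- \<i>))"
        using DERIV_mult[OF DERIV_add[OF DERIV_ident DERIV_const[of \<i>]] derP[of "- \<i>"]]
        unfolding D_def by (simp add: P1)
      have "((\<lambda>w. E w * D w) has_field_derivative c) (at (- \<i>))"
        using DERIV_mult[OF derE'[of "- \<i>"] D1] by (simp add: D_def cE)
      then have "residue f (- \<i>) = u (- \<i>) / c"
        using c0 by (intro simple) (auto simp: pts_def)
      then show ?thesis using c0 by simp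
    qed
    have res_p: "c * residue f (p r) = - s r" if r: "r \<in> {1..m}" for r
    proof -
      define Q where "Q w = (\<Prod>r'\<in>{1..m} - {r}. (w - p r') / (- \<i> - p r'))" for w
      have holQ: "Q holomorphic_on UNIV"
        unfolding Q_def using p_neq by (auto intro!: holomorphic_intros)
      have "p r \<noteq> - \<i>" using p_neq r by blast
      then have nz: "- \<i> - p r \<noteq> 0" "p r + \<i> \<noteq> 0"
        by (metis right_minus_eq) (use \<open>p r \<noteq> - \<i>\<close> in \<open>simp add: eq_neg_iff_add_eq_0\<close>)
      have Ep: "E (p r) \<noteq> 0" using E0 p_nq[OF r] by blast
      have Qp: "Q (p r) \<noteq> 0"
      proof -
        have "(p r - p r') / (- \<i> - p r') \<noteq> 0" if r': "r' \<in> {1..m} - {r}" for r'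
        proof -
          have "p r \<noteq> p r'" using inj_onD[OF inj, of r r'] r r' by blast
          moreover have "- \<i> \<noteq> p r'" using p_neq r' by (metis DiffD1)
          ultimately show ?thesis by simp
        qed
        moreover have "Q (p r) = 0 \<longleftrightarrow> (\<exists>r'\<in>{1..m} - {r}. (p r - p r') / (- \<i> - p r') = 0)"
          unfolding Q_def by (rule prod_zero_iff) simp
        ultimately show ?thesis by blast
      qed
      have PQ: "P w = (w - p r) / (- \<i> - p r) * Q w" for w
        unfolding P_def Q_def using r by (subst prod.remove[of _ r]) auto
      define G where "G w = E w * ((w + \<i>) / (- \<i> - p r) * Q w)" for w
      have ED: "E w * D w = (w - p r) * G w" for w
        by (simp add: D_def PQ G_def)
      \<comment> \<open>The quotient \<open>(p r + \<i>) / (- \<i> - p r)\<close> is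
        \<open>-1\<close>, the source of the minus sign before the sum over the nodes.\<close>
      have Gp: "G (p r) = - (E (p r) * Q (p r))"
        using nz by (simp add: G_def field_simps)
      have "G holomorphic_on UNIV"
        unfolding G_def
        by (intro holomorphic_on_mult holomorphic_on_divide holomorphic_on_add holomorphic_on_ident
            holomorphic_on_const holo holQ nz(1))
      then have dG: "(G has_field_derivative deriv G (p r)) (at (p r))"
        by (rule holomorphic_derivI) auto
      have "((\<lambda>w. E w * D w) has_field_derivative G (p r)) (at (p r))"
        using DERIV_mult[OF DERIV_diff[OF DERIV_ident DERIV_const[of "p r"]] dG]
        unfolding ED by simp
      then have "residue f (p r) = u (p r) / G (p r)"
        using r Ep Qp Gp by (intro simple) (auto simp: pts_def)
      then show ?thesis by (simp add: Gp s_def Q_def)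
    qed
    have "c / (2 * pi * \<i>) * contour_integral (\<gamma> N) f =
        (\<Sum>k\<in>{- int N..int N}. c * residue f (q k)) + c * residue f (- \<i>) + (\<Sum>r\<in>{1..m}. c * residue f (p r))"
    proof -
      have "c / y * (y * X) = c * X" if "y \<noteq> 0" for X y using that by simp
      from this[of "2 * pi * \<i>"] have "c / (2 * pi * \<i>) * (2 * pi * \<i> * X) = c * X" for X by simp
      then show ?thesis by (simp only: main) (simp only: distrib_left sum_distrib_left)
    qed
    also have "\<dots> = (\<Sum>k\<in>{- int N..int N}. - (1 / of_real a * t k)) + u (- \<i>) + (\<Sum>r\<in>{1..m}. - s r)"
      using res_q res_i res_p by simp
    also have "\<dots> = u (- \<i>) - 1 / of_real a * (\<Sum>k\<in>{- int N..int N}. t k) - (\<Sum>r\<in>{1..m}. s r)"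
      by (simp add: sum_negf sum_distrib_left)
    finally show ?thesis .
  qed

  have "(\<lambda>N. c / (2 * pi * \<i>) * contour_integral (\<gamma> N) f) \<longlonglongrightarrow> 0"
    by (rule tendsto_mult_right_zero[OF integral_lim])
  moreover have "\<forall>\<^sub>F N in sequentially. c / (2 * pi * \<i>) * contour_integral (\<gamma> N) f =
      u (- \<i>) - 1 / of_real a * (\<Sum>k\<in>{- int N..int N}. t k) - (\<Sum>r\<in>{1..m}. s r)"
    using Rlim[unfolded filterlim_at_top, rule_format, of R0]
    by eventually_elim (rule residues)
  ultimately have "(\<lambda>N. u (- \<i>) - 1 / of_real a * (\<Sum>k\<in>{- int N..int N}. t k) - (\<Sum>r\<in>{1..m}. s r)) \<longlonglongrightarrow> 0"
    by (rule Lim_transform_eventually)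
  moreover have "(\<lambda>N. u (- \<i>) - 1 / of_real a * (\<Sum>k\<in>{- int N..int N}. t k) - (\<Sum>r\<in>{1..m}. s r))
      \<longlonglongrightarrow> u (- \<i>) - 1 / of_real a * S - (\<Sum>r\<in>{1..m}. s r)"
    by (intro tendsto_intros has_sum_int_symmetric_limit[OF S])
  ultimately have "u (- \<i>) - 1 / of_real a * S - (\<Sum>r\<in>{1..m}. s r) = 0"
    using LIMSEQ_unique by blast
  moreover have "t = (\<lambda>k. c / (2 * pi * \<i> * (q k + \<i>) * P (q k)) * u (q k))"
    by (simp add: t_def D_def fun_eq_iff mult.assoc)
  ultimately show ?thesis
    using S unfolding s_def c_def P_def q_def E_def by (intro exI[of _ S]) simp
qed

section \<open>The matrix identity\<close>

text \<open>
  The inner product of matrices is the real Frobenius one, so a bound on the numerical range of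
  \<open>A\<close> applies column by column.
\<close>

lemma inner_matrix_mult_columns:
  fixes A X :: "('n::finite) cmat"
  shows "(A ** X) \<bullet> X = (\<Sum>j\<in>UNIV. (A *v column j X) \<bullet> column j X)"
  unfolding inner_vec_def matrix_matrix_mult_def matrix_vector_mult_def column_def vec_lambda_beta
  by (rule sum.swap)

lemma inner_columns:
  fixes X :: "('n::finite) cmat"
  shows "X \<bullet> X = (\<Sum>j\<in>UNIV. column j X \<bullet> column j X)"
  unfolding inner_vec_def column_def vec_lambda_beta by (rule sum.swap)

lemma norm_texp_pencil_le:
  fixes H L :: "real \<Rightarrow> ('n::finite) cmat"
  assumes "0 \<le> T" and H: "continuous_on {0..T} H" and L: "continuous_on {0..T} L"
    and herm: "\<And>t. t \<in> {0..T} \<Longrightarrow> hermitian (H t)" "\<And>t. t \<in> {0..T} \<Longrightarrow> hermitian (L t)"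
    and psd: "\<And>t. t \<in> {0..T} \<Longrightarrow> psd (L t)"
  shows "norm (texp T (\<lambda>s. cmat_scale \<i> (H s + cmat_scale z (L s)))) \<le>
    exp (max 0 (Im z) * integral {0..T} (\<lambda>t. max_eig (L t))) * norm (mat 1 :: 'n cmat)"
proof -
  define B where "B s = cmat_scale \<i> (H s + cmat_scale z (L s))" for s
  have "norm (texp T B) \<le> exp (integral {0..T} (\<lambda>t. max 0 (Im z) * max_eig (L t))) * norm (mat 1 :: 'n cmat)"
  proof (rule norm_texp_le[OF \<open>0 \<le> T\<close>])
    show "continuous_on {0..T} B"
      unfolding B_def by (intro continuous_on_add continuous_on_cmat_scale continuous_on_const H L)
    show "continuous_on {0..T} (\<lambda>t. max 0 (Im z) * max_eig (L t))"
      by (intro continuous_on_mult continuous_on_const continuous_on_max_eig L herm)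
    fix t and X :: "'n cmat" assume t: "t \<in> {0..T}"
    define q where "q = (\<Sum>j\<in>UNIV. Re (quad_form (L t) (column j X)))"
    have "- ((B t *v x) \<bullet> x) = Im z * Re (quad_form (L t) x)" for x
      using hermitian_quad_form_real[OF herm(1)[OF t], of x] hermitian_quad_form_real[OF herm(2)[OF t], of x]
      by (simp add: B_def inner_mult_eq_quad_form quad_form_scale quad_form_add)
    then have "- (B t ** X) \<bullet> X = Im z * q"
      by (simp add: inner_matrix_mult_columns q_def sum_distrib_left flip: sum_negf)
    \<comment> \<open>Semidefiniteness gives \<open>q \<ge> 0\<close>, so one rate covers both half
      planes and is \<open>0\<close> in the lower one.\<close>
    also have "\<dots> \<le> max 0 (Im z) * q"
      unfolding q_def using psd_quad_form_nonneg[OF psd[OF t]]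
      by (intro mult_right_mono sum_nonneg) auto
    also have "q \<le> max_eig (L t) * (X \<bullet> X)"
      unfolding q_def inner_columns[of X] sum_distrib_left inner_mult_eq_quad_form[symmetric]
      by (intro sum_mono max_eig_rayleigh herm t)
    finally show "- (B t ** X) \<bullet> X \<le> max 0 (Im z) * max_eig (L t) * (X \<bullet> X)"
      by (simp add: mult_left_mono mult.assoc)
  qed
  then show ?thesis by (simp add: B_def[abs_def])
qed

theorem theorem1:
  fixes T a :: real and H L :: "real \<Rightarrow> ('n::finite) cmat" and m :: nat
    and p :: "nat \<Rightarrow> complex"
  assumes "T > 0"
    and "continuous_on {0..T} H" and "continuous_on {0..T} L"
    and "\<forall>t\<in>{0..T}. hermitian (H t) \<and> hermitian (L t)"
    and "\<forall>t\<in>{0..T}. psd (L t)"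
    and "a > 0"
    and "integral {0..T} (\<lambda>t. max_eig (L t)) \<le> 2 * pi * a"
    and "m \<ge> 1"
    and "inj_on p {1..m}"
    and "\<forall>r\<in>{1..m}. p r \<noteq> - \<i>"
    and "\<forall>r\<in>{1..m}. \<forall>k::int. p r \<noteq> of_int k / of_real a"
  shows "\<exists>S. ((\<lambda>k::int. cmat_scale
              ((exp (- 2 * pi * a) - 1) /
               (2 * pi * \<i> * (of_int k / of_real a + \<i>) *
                (\<Prod>r\<in>{1..m}. (of_int k / of_real a - p r) / (- \<i> - p r))))
              (texp T (\<lambda>s. cmat_scale \<i> (H s + cmat_scale (of_int k / of_real a) (L s)))))
            has_sum S) UNIV
          \<and> texp T (\<lambda>s. L s + cmat_scale \<i> (H s))
            - cmat_scale (1 / of_real a) S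
            - (\<Sum>r\<in>{1..m}. cmat_scale
                ((exp (- 2 * pi * a) - 1) /
                 ((exp (- 2 * pi * \<i> * p r * of_real a) - 1) *
                  (\<Prod>r'\<in>{1..m} - {r}. (p r - p r') / (- \<i> - p r'))))
                (texp T (\<lambda>s. cmat_scale \<i> (H s + cmat_scale (p r) (L s)))))
            = 0"
    (is "\<exists>S. ((\<lambda>k. cmat_scale (?c k) _) has_sum S) UNIV \<and> _ - _ - (\<Sum>r\<in>_. cmat_scale (?d r) _) = 0")
proof -
  define U where "U z = texp T (\<lambda>s. cmat_scale \<i> (H s + cmat_scale z (L s)))" for z
  have U_target: "texp T (\<lambda>s. L s + cmat_scale \<i> (H s)) = U (- \<i>)"
  proof -
    have "cmat_scale \<i> (H s + cmat_scale (- \<i>) (L s)) = L s + cmat_scale \<i> (H s)" for s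
      by (simp add: vec_eq_iff cmat_scale_def algebra_simps)
    then show ?thesis by (simp add: U_def)
  qed
  have growth: "norm (U z $ i $ j) \<le> norm (mat 1 :: 'n cmat) * exp (2 * pi * a * max 0 (Im z))" for z i j
  proof -
    have "norm (U z $ i $ j) \<le> norm (U z)"
      by (meson Finite_Cartesian_Product.norm_nth_le order_trans)
    also have "\<dots> \<le> exp (max 0 (Im z) * integral {0..T} (\<lambda>t. max_eig (L t))) * norm (mat 1 :: 'n cmat)"
      unfolding U_def using assms(1-5) by (intro norm_texp_pencil_le) auto
    \<comment> \<open>Here the integrated top eigenvalue is traded for the type of the kernel;
      monotonicity holds because the prefactor is nonnegative.\<close>
    also have "\<dots> \<le> exp (max 0 (Im z) * (2 * pi * a)) * norm (mat 1 :: 'n cmat)"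
      using assms(7) by (intro mult_right_mono) (auto intro: mult_left_mono)
    finally show ?thesis by (simp add: mult_ac)
  qed
  have hol: "(\<lambda>z. U z $ i $ j) holomorphic_on UNIV" for i j
    unfolding U_def using assms(1-3) by (intro holomorphic_texp) auto
  \<comment> \<open>Packing both conclusions into one predicate lets a single choice produce all
    entries of the matrix sum.\<close>
  define Q where "Q i j s \<longleftrightarrow> ((\<lambda>k. ?c k * U (of_int k / of_real a) $ i $ j) has_sum s) UNIV \<and>
      U (- \<i>) $ i $ j - 1 / of_real a * s - (\<Sum>r\<in>{1..m}. ?d r * U (p r) $ i $ j) = 0" for i j s
  have "\<exists>s. Q i j s" for i j
    unfolding Q_def by (rule exponential_type_sampling[OF \<open>a > 0\<close> hol growth \<open>m \<ge> 1\<close> assms(9-11)])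
  then obtain S where Q: "\<And>i j. Q i j (S i j)" by metis
  have S: "((\<lambda>k. ?c k * U (of_int k / of_real a) $ i $ j) has_sum S i j) UNIV"
    and S_eq: "U (- \<i>) $ i $ j - 1 / of_real a * S i j - (\<Sum>r\<in>{1..m}. ?d r * U (p r) $ i $ j) = 0" for i j
    using Q[of i j] by (simp_all only: Q_def)
  define SM :: "'n cmat" where "SM = (\<chi> i j. S i j)"
  have "((\<lambda>k. cmat_scale (?c k) (U (of_int k / of_real a))) has_sum SM) UNIV"
    unfolding has_sum_def
  proof (intro vec_tendstoI)
    fix i j
    show "((\<lambda>F. (\<Sum>k\<in>F. cmat_scale (?c k) (U (of_int k / of_real a))) $ i $ j) \<longlongrightarrow> SM $ i $ j)
        (finite_subsets_at_top UNIV)"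
      using S[of i j] by (simp add: has_sum_def SM_def cmat_scale_def)
  qed
  moreover have "U (- \<i>) - cmat_scale (1 / of_real a) SM - (\<Sum>r\<in>{1..m}. cmat_scale (?d r) (U (p r))) = 0"
    using S_eq by (simp add: vec_eq_iff cmat_scale_def SM_def)
  ultimately show ?thesis
    unfolding U_target U_def by blast
qed

end
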